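(* Let $(i_1,\ldots,i_{K+1})\in\mathcal A_{K+1}$ be fixed. Equalities of events are understood almost surely. (1) If $(i_1,\ldots,i_K)$ satisfies the Irrepresentable Check then, for all $0\le a<k\le K$, $$\{\hat\imath_1=i_1,\ldots,\hat\imath_{k+1}=i_{k+1}\}=\big\{\lambda_{k+1}^{(i_1,\ldots,i_k)}=Z_{i_{k+1}}^{(i_1,\ldots,i_k)}\le Z_{i_k}^{(i_1,\ldots,i_{k-1})}\le\cdots\le Z_{i_2}^{(i_1)}\le Z_{i_1}\big\}$$ $$=\big\{\lambda_{k+1}^{(i_1,\ldots,i_k)}=Z_{i_{k+1}}^{(i_1,\ldots,i_k)}\le Z_{i_k}^{(i_1,\ldots,i_{k-1})}\le\cdots\le Z_{i_{a+1}}^{(i_1,\ldots,i_a)}\le Z_{i_a}^{(i_1,\ldots,i_{a-1})}=\lambda_a^{(i_1,\ldots,i_{a-1})}\big\}$$ $$\cap\big\{\lambda_{k+1}=Z_{i_{k+1}}^{(i_1,\ldots,i_k)},\ldots,\lambda_a=Z_{i_a}^{(i_1,\ldots,i_{a-1})}\big\}\cap\{\hat\imath_1=i_1,\ldots,\hat\imath_a=i_a\},$$ with the convention $\lambda_0=\infty$ (for $a=0$ the conditions carrying index $0$ are void). (2) For any $k\in[K]$, the random elements $(Z_j^{(i_1,\ldots,i_k)})_{j\ne i_1,\ldots,i_k}$, $Z_{i_k}^{(i_1,\ldots,i_{k-1})}$, $Z_{i_{k-1}}^{(i_1,\ldots,i_{k-2})},\ldots,Z_{i_2}^{(i_1)},Z_{i_1}$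 are mutually independent. Furthermore, if $X\beta^0\in\mathrm{Span}(X_{j_1},\ldots,X_{j_K})$ then $$\hat\sigma^{i_1,\ldots,i_K},\quad\Big(\frac{Z_j^{(i_1,\ldots,i_K)}}{\hat\sigma^{i_1,\ldots,i_K}}\Big)_{j\ne i_1,\ldots,i_K},\quad Z_{i_K}^{(i_1,\ldots,i_{K-1})},\ldots,Z_{i_2}^{(i_1)},\ Z_{i_1}$$ are mutually independent. (3) If $(i_1,\ldots,i_K)$ satisfies the Irrepresentable Check then $$\{\hat\imath_1=i_1,\ldots,\hat\imath_K=i_K\}=\big\{\lambda_{K+1}^{(i_1,\ldots,i_K)}\le Z_{i_K}^{(i_1,\ldots,i_{K-1})}\le\cdots\le Z_{i_2}^{(i_1)}\le Z_{i_1}\big\}$$ $$=\Big\{\Lambda_{K+1}^{(i_1,\ldots,i_K)}:=\frac{\lambda_{K+1}^{(i_1,\ldots,i_K)}}{\hat\sigma^{i_1,\ldots,i_K}}\le\frac{Z_{i_K}^{(i_1,\ldots,i_{K-1})}}{\hat\sigma^{i_1,\ldots,i_K}}\le\cdots\le\frac{Z_{i_2}^{(i_1)}}{\hat\sigma^{i_1,\ldots,i_K}}\le\frac{Z_{i_1}}{\hat\sigma^{i_1,\ldots,i_K}}\Big\}.$$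
   Context: Notation: $[m]=\{1,\ldots,m\}$. Let $X\in\mathbb R^{n\times p}$ be a fixed matrix of rank $r>0$ with columns $X_1,\ldots,X_p$, and $Y=X\beta^0+\eta$ with $\beta^0\in\mathbb R^p$, $\eta\sim\mathcal N_n(0,\sigma^2\mathrm{Id}_n)$, $\sigma>0$. $K$ is a fixed integer with $1\le K<\min(n,r)$. Signed indices: $i\in[2p]$ encodes a variable $j\in[p]$ and a sign $s\in\{\pm1\}$ via $i=j+p\frac{1-s}{2}$; $j_k$ denotes the variable encoded by $i_k$. $\mathcal A_k$ is the set of $(i_1,\ldots,i_k)\in[2p]^k$ with pairwise different underlying variables. Put $\bar Z=X^\top Y$, $Z=(\bar Z,-\bar Z)\in\mathbb R^{2p}$, with covariance $\sigma^2R$, $R=\begin{pmatrix}X^\top X&-X^\top X\\-X^\top X&X^\top X\end{pmatrix}$. For $i_1,\ldots,i_k\in[2p]$ let $M_{i_1,\ldots,i_k}$ be the submatrix of $R$ with rows and columns indexed by $i_1,\ldots,i_k$ (assumed invertible wherever its inverse is used), and for $j\in[2p]$ let $\theta_j(i_1,\ldots,i_k)=(R_{j,i_1}\cdots R_{j,i_k})M_{i_1,\ldots,i_k}^{-1}(1,\ldots,1)^\top$ and $\Pi_{i_1,\ldots,i_k}(Z_j)=(R_{j,i_1}\cdots R_{j,i_k})M_{i_1,\ldots,i_k}^{-1}(Z_{i_1},\ldots,Z_{i_k})^\top$ (both are $0$ when $k=0$). Frozen variables: for $j$ with $\theta_j(i_1,\ldots,i_k)\ne1$, $Z_j^{(i_1,\ldots,i_k)}=\frac{Z_j-\Pi_{i_1,\ldots,i_k}(Z_j)}{1-\theta_j(i_1,\ldots,i_k)}$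 (only indices for which this is defined are considered), and $\lambda_{k+1}^{(i_1,\ldots,i_k)}=\max_{j:\theta_j(i_1,\ldots,i_k)<1}Z_j^{(i_1,\ldots,i_k)}$, $k\ge0$. LARS knots $\lambda_1\ge\lambda_2\ge\cdots$ and signed variables $\hat\imath_1,\hat\imath_2,\ldots$: $\lambda_k=\lambda_k^{(\hat\imath_1,\ldots,\hat\imath_{k-1})}$ and $\hat\imath_k$ is the corresponding argmax, for $k\ge1$. $(i_1,\ldots,i_K)\in\mathcal A_K$ satisfies the Irrepresentable Check if for all $k\in[K]$ the matrix $M_{i_1,\ldots,i_k}$ is invertible and $\theta_j(i_1,\ldots,i_k)<1$ for all $j\in[2p]\setminus\{i_1,\ldots,i_k\}$. $\hat\sigma^{i_1,\ldots,i_K}=\|P^\perp Y\|_2/\sqrt{n-K}$ where $P^\perp$ is the orthogonal projection onto the orthogonal complement of $\mathrm{Span}(X_{j_1},\ldots,X_{j_K})$.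
   Formalization: In the first equality of (1) for k=K only, the argmax defining î_{K+1} is assumed to be almost surely unique; otherwise ties (e.g. two equal unselected columns of X) leave î_{K+1} undefined and the equality can fail. *)

theory Defs
  imports "HOL-Probability.Probability" "Jordan_Normal_Form.Gauss_Jordan_Elimination"
begin

(* "$" is reserved for the components of HOL-Analysis vectors *)
no_notation Matrix.vec_index (infixl \<open>$\<close> 100)

text \<open>
  Signed indices are elements of the type \<^typ>\<open>'p + 'p\<close>, where \<open>'p\<close> indexes the columns of the
  design: \<open>Inl j\<close> is the variable \<open>j\<close> with sign \<open>+1\<close> (the index \<open>j\<close> in \<open>{1..2p}\<close>), and
  \<open>Inr j\<close> is the variable \<open>j\<close> with sign \<open>-1\<close> (the index \<open>j + p\<close>).
\<close>

definition var :: "'p + 'p \<Rightarrow> 'p" where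
  "var i = (case i of Inl j \<Rightarrow> j | Inr j \<Rightarrow> j)"

definition var_sign :: "'p + 'p \<Rightarrow> real" where
  "var_sign i = (case i of Inl j \<Rightarrow> 1 | Inr j \<Rightarrow> - 1)"

text \<open>
  Sequences are numbered from 1: \<open>pre i k\<close> is the tuple \<open>(i\<^sub>1, ..., i\<^sub>k)\<close>.
\<close>

definition pre :: "(nat \<Rightarrow> 'a) \<Rightarrow> nat \<Rightarrow> 'a list" where
  "pre i k = map i [1..<Suc k]"

definition signed_tuples :: "nat \<Rightarrow> ('p + 'p) list set" where
  "signed_tuples k = {is. length is = k \<and> distinct (map var is)}"

definition gaussian_noise :: "'w measure \<Rightarrow> real \<Rightarrow> ('w \<Rightarrow> real^'n) \<Rightarrow> bool" where
  "gaussian_noise M \<sigma> \<eta> \<longleftrightarrow>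
     distributed M lborel \<eta> (\<lambda>x. ennreal (\<Prod>a\<in>UNIV. normal_density 0 \<sigma> (x $ a)))"

definition Zvec :: "real^'p^'n \<Rightarrow> real^'n \<Rightarrow> real^('p + 'p)" where
  "Zvec X y = (\<chi> i. var_sign i * (Finite_Cartesian_Product.transpose X *v y) $ var i)"

definition Rmat :: "real^'p^'n \<Rightarrow> real^('p + 'p)^('p + 'p)" where
  "Rmat X = (\<chi> i i'. var_sign i * var_sign i' * (Finite_Cartesian_Product.transpose X ** X) $ var i $ var i')"

definition R_sub :: "real^'p^'n \<Rightarrow> ('p + 'p) list \<Rightarrow> real Matrix.mat" where
  "R_sub X is = Matrix.mat (length is) (length is) (\<lambda>(a, b). Rmat X $ (is ! a) $ (is ! b))"

definition R_row :: "real^'p^'n \<Rightarrow> ('p + 'p) list \<Rightarrow> 'p + 'p \<Rightarrow> real Matrix.vec" where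
  "R_row X is j = Matrix.vec (length is) (\<lambda>a. Rmat X $ j $ (is ! a))"

text \<open>
  \<^term>\<open>mat_inverse\<close> returns \<^term>\<open>None\<close> on singular matrices, so \<open>\<theta>\<close> and the projection are
  meaningful only if \<^term>\<open>R_sub X is\<close> is invertible (which includes \<open>is = []\<close>).
\<close>

definition regress :: "real^'p^'n \<Rightarrow> ('p + 'p) list \<Rightarrow> real Matrix.vec \<Rightarrow> 'p + 'p \<Rightarrow> real" where
  "regress X is v j = scalar_prod (R_row X is j) (the (mat_inverse (R_sub X is)) *\<^sub>v v)"

definition \<theta> :: "real^'p^'n \<Rightarrow> ('p + 'p) list \<Rightarrow> 'p + 'p \<Rightarrow> real" where
  "\<theta> X is j = regress X is (Matrix.vec (length is) (\<lambda>a. 1)) j"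

definition proj_Z :: "real^'p^'n \<Rightarrow> real^'n \<Rightarrow> ('p + 'p) list \<Rightarrow> 'p + 'p \<Rightarrow> real" where
  "proj_Z X y is j = regress X is (Matrix.vec (length is) (\<lambda>a. Zvec X y $ (is ! a))) j"

definition frozen :: "real^'p^'n \<Rightarrow> real^'n \<Rightarrow> ('p + 'p) list \<Rightarrow> 'p + 'p \<Rightarrow> real" where
  "frozen X y is j = (Zvec X y $ j - proj_Z X y is j) / (1 - \<theta> X is j)"

definition frozen_max :: "real^'p^'n \<Rightarrow> real^'n \<Rightarrow> ('p + 'p) list \<Rightarrow> real" where
  "frozen_max X y is = Max (frozen X y is ` {j. \<theta> X is j < 1})"

definition frozen_argmax :: "real^'p^'n \<Rightarrow> real^'n \<Rightarrow> ('p + 'p) list \<Rightarrow> 'p + 'p \<Rightarrow> bool" where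
  "frozen_argmax X y is j \<longleftrightarrow> is_arg_max (frozen X y is) (\<lambda>j. \<theta> X is j < 1) j"

text \<open>
  \<open>frozen_at X y i k\<close> is \<open>Z\<close> at \<open>i\<^sub>k\<close> frozen by \<open>(i\<^sub>1, ..., i\<^sub>k\<^sub>-\<^sub>1)\<close>, for \<open>k \<ge> 1\<close>.
\<close>

definition frozen_at :: "real^'p^'n \<Rightarrow> real^'n \<Rightarrow> (nat \<Rightarrow> 'p + 'p) \<Rightarrow> nat \<Rightarrow> real" where
  "frozen_at X y i k = frozen X y (pre i (k - 1)) (i k)"

text \<open>
  A sequence of signed variables selected in the first \<open>m\<close> steps of LARS, and the knots that it
  defines. When several indices attain a maximum, any of them may be selected.
\<close>

definition lars_selection :: "real^'p^'n \<Rightarrow> real^'n \<Rightarrow> nat \<Rightarrow> (nat \<Rightarrow> 'p + 'p) \<Rightarrow> bool" where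
  "lars_selection X y m \<iota> \<longleftrightarrow> (\<forall>k\<in>{1..m}. frozen_argmax X y (pre \<iota> (k - 1)) (\<iota> k))"

definition lars_knot :: "real^'p^'n \<Rightarrow> real^'n \<Rightarrow> (nat \<Rightarrow> 'p + 'p) \<Rightarrow> nat \<Rightarrow> real" where
  "lars_knot X y \<iota> k = frozen_max X y (pre \<iota> (k - 1))"

definition irrepresentable_check :: "real^'p^'n \<Rightarrow> ('p + 'p) list \<Rightarrow> bool" where
  "irrepresentable_check X is \<longleftrightarrow>
     (\<forall>k\<in>{1..length is}. invertible_mat (R_sub X (take k is)) \<and>
        (\<forall>j. j \<notin> set (take k is) \<longrightarrow> \<theta> X (take k is) j < 1))"

definition selected_span :: "real^'p^'n \<Rightarrow> ('p + 'p) list \<Rightarrow> (real^'n) set" where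
  "selected_span X is = span ((\<lambda>i. column (var i) X) ` set is)"

definition orth_projection :: "'a::euclidean_space set \<Rightarrow> 'a \<Rightarrow> 'a" where
  "orth_projection U y = (THE v. v \<in> U \<and> (\<forall>u\<in>U. real_inner_class.orthogonal (y - v) u))"

definition sigma_hat :: "real^'p^'n \<Rightarrow> real^'n \<Rightarrow> ('p + 'p) list \<Rightarrow> real" where
  "sigma_hat X y is =
     norm (orth_projection (orthogonal_comp (selected_span X is)) y)
       / sqrt (real CARD('n) - real (length is))"

text \<open>
  Mutual independence of random elements with different value types is independence of the
  \<open>\<sigma>\<close>-algebras that they generate. \<^term>\<open>prob_space.indep_sets\<close> requires its sets to be events, so
  it includes the measurability of these random elements.
\<close>

definition generated :: "'w measure \<Rightarrow> 'b measure \<Rightarrow> ('w \<Rightarrow> 'b) \<Rightarrow> 'w set set" where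
  "generated M N f = sets (vimage_algebra (space M) f N)"

definition frozen_idx :: "real^'p^'n \<Rightarrow> ('p + 'p) list \<Rightarrow> ('p + 'p) set" where
  "frozen_idx X is = {j. j \<notin> set is \<and> \<theta> X is j \<noteq> 1}"

lemma the_mat_inverse:
  assumes "A \<in> carrier_mat m m" and "invertible_mat (A :: real Matrix.mat)"
  shows "the (mat_inverse A) \<in> carrier_mat m m"
    and "A * the (mat_inverse A) = 1\<^sub>m m" and "the (mat_inverse A) * A = 1\<^sub>m m"
proof -
  obtain B where AB: "A * B = 1\<^sub>m (dim_row A)" and BA: "B * A = 1\<^sub>m (dim_row B)"
    using assms(2) by (auto simp: invertible_mat_def inverts_mat_def)
  have "dim_col B = m" "dim_row B = m"
    using arg_cong[OF AB, of dim_col] arg_cong[OF BA, of dim_col] assms(1) by auto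
  then have "B \<in> carrier_mat m m" by auto
  then have "A \<in> Units (ring_mat TYPE(real) m ())"
    using AB BA assms(1) by (auto simp: Units_def ring_mat_def intro!: bexI[of _ B])
  then obtain C where "mat_inverse A = Some C"
    using mat_inverse(1)[OF assms(1), of "()"] by (cases "mat_inverse A") auto
  then show "the (mat_inverse A) \<in> carrier_mat m m"
    and "A * the (mat_inverse A) = 1\<^sub>m m" and "the (mat_inverse A) * A = 1\<^sub>m m"
    using mat_inverse(2)[OF assms(1)] by auto
qed

lemma regress_Nil: "regress X [] v j = 0"
proof -
  have "invertible_mat (R_sub X [])"
    by (auto simp: R_sub_def invertible_mat_def inverts_mat_def square_mat.simps
        intro!: exI[of _ "1\<^sub>m 0"])
  then have "the (mat_inverse (R_sub X [])) \<in> carrier_mat 0 0"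
    by (intro the_mat_inverse(1)) (auto simp: R_sub_def)
  then show ?thesis by (simp add: regress_def scalar_prod_def)
qed

lemma \<theta>_Nil: "\<theta> X [] j = 0"
  by (simp add: \<theta>_def regress_Nil)

lemma frozen_Nil: "frozen X y [] j = Zvec X y $ j"
  by (simp add: frozen_def proj_Z_def \<theta>_Nil regress_Nil)

end

theory Submission
  imports Defs
begin

text \<open>
  Write \<open>x\<^sub>i\<close> for the column of \<open>X\<close> named by the signed index \<open>i\<close>, multiplied by its sign, so that
  \<open>Z\<^sub>i = x\<^sub>i \<bullet> Y\<close> and \<open>R\<^sub>i\<^sub>j = x\<^sub>i \<bullet> x\<^sub>j\<close>.  Regression on a tuple is then the geometry of the span
  \<open>V\<close> of its columns: \<open>\<theta>\<^sub>j = x\<^sub>j \<bullet> w\<close>, where \<open>w\<close> is the vector of \<open>V\<close> that has inner product 1 with every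
  column of the tuple, and the frozen variable is \<open>(P x\<^sub>j \<bullet> Y) / (1 - \<theta>\<^sub>j)\<close>, where \<open>P\<close> is the orthogonal
  projection onto the complement of \<open>V\<close> (\<open>frozen_eq_inner\<close>).

  Appending an index \<open>i\<close> to the tuple is a Gram--Schmidt step with direction
  \<open>u = P x\<^sub>i\<close>.  Numerator and denominator of every frozen variable change by the same rule,
  \<open>N\<^sub>j \<mapsto> N\<^sub>j - \<rho> N\<^sub>i\<close> and \<open>d\<^sub>j \<mapsto> d\<^sub>j - \<rho> d\<^sub>i\<close> with \<open>\<rho> = (u \<bullet> x\<^sub>j) / (u \<bullet> u)\<close>.  While the denominators are
  positive, the new quotient is at most \<open>N\<^sub>i / d\<^sub>i\<close> if and only if the old one is
  (\<open>frozen_snoc_le_iff\<close>).  The Irrepresentable Check keeps all denominators positive, so the next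
  maximum is at most \<open>Z\<close> at \<open>i\<close> exactly when \<open>i\<close> attains the present maximum.  Hence a decreasing
  chain that starts at the last maximum can be read backwards: it says that each \<open>i\<^sub>l\<close> attains the
  maximum of its step (\<open>lars_selection_iff_max_le\<close>).  At such a step among the first \<open>K\<close>, the
  maximum is almost surely attained only once, because two frozen variables with a common direction
  \<open>P x\<^sub>j / (1 - \<theta>\<^sub>j)\<close> would give \<open>\<theta>\<^sub>j = 1\<close> after the step, and for different directions a tie puts the
  Gaussian vector on a hyperplane (\<open>AE_argmax_unique\<close>); for step \<open>K + 1\<close> uniqueness is a hypothesis
  where it matters.  So the selected sequence is the given one as soon as the latter is a possible
  selection.

  For the independence, the directions \<open>u\<^sub>l\<close> of the successive Gram--Schmidt steps are orthogonal, and
  \<open>Z\<close> at \<open>i\<^sub>l\<close> depends on \<open>Y\<close> only through \<open>u\<^sub>l \<bullet> Y\<close>, while the variables frozen by all \<open>k\<close> indices depend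
  only on the projection of \<open>Y\<close> onto the complement.  In an orthonormal basis that contains the
  normalized \<open>u\<^sub>l\<close>, the noise is again a vector of independent Gaussians, since its density depends
  only on the norm and orthogonal maps preserve Lebesgue measure; these objects use disjoint blocks
  of coordinates (\<open>frozen_in_innovation_coordinates\<close>).  If the mean lies in the selected span, the
  estimator of the standard deviation is, up to a constant, the norm of the last block.  The
  other coordinates and the quotients by this norm do not change when the last block is rescaled,
  and events with this invariance are independent of the norm of the block, because Lebesgue
  measure scales by a power of the factor (\<open>block_scale_invariant_indep_block_norm\<close>).
\<close>

no_notation Matrix.scalar_prod (infix \<open>\<bullet>\<close> 70)

section \<open>Orthogonal projections\<close>

lemma orth_projection_eqI:
  fixes U :: "'a::euclidean_space set"
  assumes "subspace U" "v \<in> U" "\<And>u. u \<in> U \<Longrightarrow> (y - v) \<bullet> u = 0"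
  shows "orth_projection U y = v"
  unfolding orth_projection_def
proof (rule the_equality)
  show "v \<in> U \<and> (\<forall>u\<in>U. real_inner_class.orthogonal (y - v) u)"
    using assms by (auto simp: real_inner_class.orthogonal_def)
next
  fix v' assume v': "v' \<in> U \<and> (\<forall>u\<in>U. real_inner_class.orthogonal (y - v') u)"
  have d: "v - v' \<in> U"
    using v' assms by (simp add: subspace_diff)
  have "(v - v') \<bullet> (v - v') = (y - v') \<bullet> (v - v') - (y - v) \<bullet> (v - v')"
    by (simp add: inner_diff_left)
  also have "\<dots> = 0"
    using v' assms(3)[OF d] d by (simp add: real_inner_class.orthogonal_def)
  finally show "v' = v" by simp
qed

text \<open>
  The projection onto the orthogonal complement of a subspace, written so that the subspace itself
  remains the parameter along which columns are added.
\<close>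

definition orth_residual :: "'a::euclidean_space set \<Rightarrow> 'a \<Rightarrow> 'a" where
  "orth_residual U y = y - orth_projection U y"

lemma
  fixes U :: "'a::euclidean_space set"
  assumes U: "subspace U"
  shows orth_projection_in: "orth_projection U y \<in> U"
    and orth_residual_orth: "u \<in> U \<Longrightarrow> orth_residual U y \<bullet> u = 0"
proof -
  obtain v z where vz: "v \<in> span U" "\<And>w. w \<in> span U \<Longrightarrow> real_inner_class.orthogonal z w" "y = v + z"
    using orthogonal_subspace_decomp_exists[of U y] by blast
  have "span U = U" using U by (simp add: span_eq_iff)
  note vz = vz[unfolded this real_inner_class.orthogonal_def]
  have "orth_projection U y = v"
    using vz by (intro orth_projection_eqI[OF U]) auto
  then show "orth_projection U y \<in> U" and "u \<in> U \<Longrightarrow> orth_residual U y \<bullet> u = 0"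
    using vz by (auto simp: orth_residual_def)
qed

lemma orth_residual_self_adjoint:
  fixes U :: "'a::euclidean_space set"
  assumes "subspace U"
  shows "orth_residual U x \<bullet> y = x \<bullet> orth_residual U y"
proof -
  have "orth_residual U x \<bullet> orth_projection U y = 0" "orth_projection U x \<bullet> orth_residual U y = 0"
    using assms by (simp_all add: orth_residual_orth orth_projection_in inner_commute[of "orth_projection U x"])
  then show ?thesis
    by (simp add: orth_residual_def inner_diff_left inner_diff_right)
qed

lemma orth_residual_eq_0:
  fixes U :: "'a::euclidean_space set"
  assumes "subspace U" "x \<in> U"
  shows "orth_residual U x = 0"
  using orth_projection_eqI[of U x x] assms by (simp add: orth_residual_def)

lemma orth_residual_add:
  fixes U :: "'a::euclidean_space set"
  assumes "subspace U"
  shows "orth_residual U (x + y) = orth_residual U x + orth_residual U y"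
proof -
  have "orth_projection U (x + y) = orth_projection U x + orth_projection U y"
  proof (rule orth_projection_eqI[OF assms])
    show "orth_projection U x + orth_projection U y \<in> U"
      using assms by (simp add: orth_projection_in subspace_add)
    have "x + y - (orth_projection U x + orth_projection U y) = orth_residual U x + orth_residual U y"
      by (simp add: orth_residual_def)
    then show "(x + y - (orth_projection U x + orth_projection U y)) \<bullet> u = 0" if "u \<in> U" for u
      by (simp only: inner_add_left orth_residual_orth[OF assms that])
  qed
  then show ?thesis by (simp add: orth_residual_def)
qed

lemma orth_projection_complement:
  fixes U :: "'a::euclidean_space set"
  assumes "subspace U"
  shows "orth_projection (orthogonal_comp U) y = orth_residual U y"
proof (rule orth_projection_eqI)
  show "subspace (orthogonal_comp U)" by (rule subspace_orthogonal_comp)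
  show "orth_residual U y \<in> orthogonal_comp U"
    using orth_residual_orth[OF assms]
    by (auto simp: orthogonal_comp_def real_inner_class.orthogonal_def inner_commute)
  show "(y - orth_residual U y) \<bullet> u = 0" if "u \<in> orthogonal_comp U" for u
    using that orth_projection_in[OF assms]
    by (auto simp: orth_residual_def orthogonal_comp_def real_inner_class.orthogonal_def)
qed

text \<open>Gram--Schmidt step.  If \<open>x \<in> U\<close> the quotient is \<open>0 / 0 = 0\<close> and the formula still holds.\<close>

lemma orth_residual_insert:
  fixes U :: "'a::euclidean_space set" and x :: 'a
  assumes U: "subspace U"
  defines "u \<equiv> orth_residual U x"
  shows "orth_residual (span (insert x U)) y = orth_residual U y - ((u \<bullet> y) / (u \<bullet> u)) *\<^sub>R u"
proof -
  let ?c = "(u \<bullet> y) / (u \<bullet> u)"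
  have uU: "u \<bullet> w = 0" if "w \<in> U" for w
    using orth_residual_orth[OF U that] by (simp add: u_def)
  have xu: "x = orth_projection U x + u" by (simp add: u_def orth_residual_def)
  have Px: "orth_projection U x \<in> U" and Py: "orth_projection U y \<in> U"
    using U by (simp_all add: orth_projection_in)
  have ux: "u \<bullet> x = u \<bullet> u"
    using uU[OF Px] by (subst xu) (simp add: inner_add_right)
  have uy: "u \<bullet> y = u \<bullet> orth_residual U y"
    using uU[OF Py] by (simp add: orth_residual_def inner_diff_right)
  have "orth_projection (span (insert x U)) y = orth_projection U y + ?c *\<^sub>R u"
  proof (rule orth_projection_eqI)
    have "u \<in> span (insert x U)"
      unfolding u_def orth_residual_def by (intro span_diff span_base) (use Px in auto)
    then show "orth_projection U y + ?c *\<^sub>R u \<in> span (insert x U)"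
      by (intro span_add span_scale) (use Py in \<open>auto intro: span_base\<close>)
  next
    fix z assume "z \<in> span (insert x U)"
    then show "(y - (orth_projection U y + ?c *\<^sub>R u)) \<bullet> z = 0"
    proof (induction rule: span_induct_alt)
      case (step c b z)
      have y: "y - (orth_projection U y + ?c *\<^sub>R u) = orth_residual U y - ?c *\<^sub>R u"
        by (simp add: orth_residual_def)
      have "(orth_residual U y - ?c *\<^sub>R u) \<bullet> b = 0"
      proof (cases "b \<in> U")
        case True
        then show ?thesis by (simp add: inner_diff_left orth_residual_orth[OF U] uU)
      next
        case False
        then have "b = x" using step by simp
        have "orth_residual U y \<bullet> x = orth_residual U y \<bullet> u"
          by (subst xu) (simp add: inner_add_right orth_residual_orth[OF U Px])
        then have "orth_residual U y \<bullet> x = u \<bullet> y"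
          by (simp add: uy inner_commute)
        then show ?thesis
          using ux by (cases "u = 0") (auto simp: \<open>b = x\<close> inner_diff_left)
      qed
      then show ?case using step unfolding y by (simp add: inner_add_right)
    qed simp
  qed simp
  then show ?thesis by (simp add: orth_residual_def)
qed

text \<open>
  The uniqueness principle behind all formulas with \<open>M\<inverse>\<close>: once a vector is known to lie in the
  span, it is identified by its inner products with the generators, so that the entries of the
  inverse matrix need not be computed.
\<close>

lemma eq_if_inner_eq_on_span:
  fixes w w' :: "'a::euclidean_space"
  assumes "w \<in> span B" "w' \<in> span B" "\<And>b. b \<in> B \<Longrightarrow> b \<bullet> w = b \<bullet> w'"
  shows "w = w'"
proof -
  have "real_inner_class.orthogonal (w - w') z" if "z \<in> span B" for z
    by (rule orthogonal_to_span[OF that])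
      (simp add: real_inner_class.orthogonal_def inner_diff_right inner_commute[of "w - w'"] assms(3))
  from this[of "w - w'"] show ?thesis
    using assms by (auto simp: span_diff real_inner_class.orthogonal_def)
qed

lemma span_insert_span:
  fixes B :: "'a::real_vector set"
  shows "span (insert a (span B)) = span (insert a B)"
proof (rule subset_antisym)
  have "span B \<subseteq> span (insert a B)" by (intro span_mono) auto
  then show "span (insert a (span B)) \<subseteq> span (insert a B)"
    by (intro span_minimal) (auto intro: span_base)
  show "span (insert a B) \<subseteq> span (insert a (span B))"
    by (intro span_mono) (auto intro: span_base)
qed

section \<open>Regression on signed columns\<close>

text \<open>
  With the sign absorbed into the column, \<open>Z\<close> and \<open>R\<close> become inner products and the two halves of
  the index set are treated alike.
\<close>

definition signed_column :: "real^'p^'n \<Rightarrow> 'p + 'p \<Rightarrow> real^'n" where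
  "signed_column X i = var_sign i *\<^sub>R column (var i) X"

lemma Zvec_eq_inner: "Zvec X y $ i = signed_column X i \<bullet> y"
  by (simp add: Zvec_def signed_column_def matrix_vector_mult_def Finite_Cartesian_Product.transpose_def
      inner_vec_def column_def sum_distrib_left algebra_simps)

lemma Rmat_eq_inner: "Rmat X $ i $ j = signed_column X i \<bullet> signed_column X j"
  by (simp add: Rmat_def signed_column_def matrix_matrix_mult_def Finite_Cartesian_Product.transpose_def
      inner_vec_def column_def sum_distrib_left algebra_simps)

lemma selected_span_eq: "selected_span X is = span (signed_column X ` set is)"
proof -
  have sq: "column (var i) X = var_sign i *\<^sub>R signed_column X i" for i
    by (cases i) (simp_all add: signed_column_def var_sign_def)
  have "column (var i) X \<in> span (signed_column X ` set is)" if "i \<in> set is" for i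
    unfolding sq using that by (intro span_scale span_base) simp
  moreover have "signed_column X i \<in> span ((\<lambda>i. column (var i) X) ` set is)" if "i \<in> set is" for i
    unfolding signed_column_def using that by (intro span_scale span_base) simp
  ultimately show ?thesis
    unfolding selected_span_def by (intro subset_antisym span_minimal) auto
qed

lemma subspace_selected_span: "subspace (selected_span X is)"
  by (simp add: selected_span_def)

lemma signed_column_in_selected_span: "i \<in> set is \<Longrightarrow> signed_column X i \<in> selected_span X is"
  by (simp add: selected_span_eq span_base)

lemma selected_span_snoc:
  "selected_span X (is @ [i]) = span (insert (signed_column X i) (selected_span X is))"
  by (simp add: selected_span_eq span_insert_span)

lemma dim_selected_span: "dim (selected_span X is) \<le> length is"
proof -
  have "dim (selected_span X is) \<le> card ((\<lambda>i. column (var i) X) ` set is)"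
    by (simp add: selected_span_def dim_le_card')
  also have "\<dots> \<le> length is"
    by (meson card_image_le card_length finite_set order_trans)
  finally show ?thesis .
qed

lemma invertible_R_sub_Nil: "invertible_mat (R_sub X [])"
  by (auto simp: R_sub_def invertible_mat_def inverts_mat_def square_mat.simps
      intro!: exI[of _ "1\<^sub>m 0"])

text \<open>
  The coefficients \<open>M\<inverse> v\<close> are those of a vector of the selected span whose inner products with the
  selected columns are the entries of \<open>v\<close>.  This is the only place where the matrix inverse is used;
  later proofs refer to the vector.
\<close>

lemma regress_representer:
  fixes X :: "real^'p^'n"
  assumes inv: "invertible_mat (R_sub X is)" and v: "dim_vec v = length is"
  obtains w where "w \<in> selected_span X is"
    and "\<And>b. b < length is \<Longrightarrow> signed_column X (is ! b) \<bullet> w = Matrix.vec_index v b"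
    and "\<And>j. regress X is v j = signed_column X j \<bullet> w"
proof -
  let ?m = "length is"
  let ?C = "the (mat_inverse (R_sub X is))"
  define c where "c = ?C *\<^sub>v v"
  have R: "R_sub X is \<in> carrier_mat ?m ?m" by (simp add: R_sub_def)
  note C = the_mat_inverse[OF R inv]
  have v': "v \<in> carrier_vec ?m" using v by (rule carrier_vecI)
  have c: "dim_vec c = ?m" using C(1) by (auto simp: c_def)
  have Rc: "R_sub X is *\<^sub>v c = v"
    using assoc_mult_mat_vec[OF R C(1) v'] C(2) v' by (simp add: c_def)
  define w where "w = (\<Sum>a<?m. Matrix.vec_index c a *\<^sub>R signed_column X (is ! a))"
  have inner_w: "signed_column X j \<bullet> w = (\<Sum>a<?m. Rmat X $ j $ (is ! a) * Matrix.vec_index c a)" for j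
    unfolding w_def by (simp add: inner_sum_right Rmat_eq_inner mult.commute)
  show thesis
  proof (rule that)
    show "w \<in> selected_span X is"
      unfolding w_def by (intro subspace_sum subspace_scale subspace_selected_span
          signed_column_in_selected_span) simp
    show "signed_column X (is ! b) \<bullet> w = Matrix.vec_index v b" if "b < ?m" for b
    proof -
      have "Matrix.vec_index v b = Matrix.vec_index (R_sub X is *\<^sub>v c) b" by (simp only: Rc)
      also have "\<dots> = scalar_prod (Matrix.row (R_sub X is) b) c"
        using that R by (intro index_mult_mat_vec) auto
      also have "\<dots> = (\<Sum>a<?m. Rmat X $ (is ! b) $ (is ! a) * Matrix.vec_index c a)"
        using that by (simp add: scalar_prod_def c R_sub_def atLeast0LessThan)
      finally show ?thesis by (simp add: inner_w)
    qed
    show "regress X is v j = signed_column X j \<bullet> w" for j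
      unfolding inner_w regress_def scalar_prod_def c_def[symmetric] c
      by (simp add: R_row_def atLeast0LessThan)
  qed
qed

lemma \<theta>_representer:
  assumes "invertible_mat (R_sub X is)"
  obtains w where "w \<in> selected_span X is"
    and "\<And>i. i \<in> set is \<Longrightarrow> signed_column X i \<bullet> w = 1"
    and "\<And>j. \<theta> X is j = signed_column X j \<bullet> w"
proof -
  obtain w where "w \<in> selected_span X is"
    and "\<And>b. b < length is \<Longrightarrow> signed_column X (is ! b) \<bullet> w = 1"
    and "\<And>j. \<theta> X is j = signed_column X j \<bullet> w"
    using regress_representer[OF assms, of "Matrix.vec (length is) (\<lambda>a. 1)"]
    by (auto simp: \<theta>_def)
  then show thesis by (intro that[of w]) (auto simp: in_set_conv_nth)
qed

lemma \<theta>_selected: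
  assumes "invertible_mat (R_sub X is)" "j \<in> set is"
  shows "\<theta> X is j = 1"
  using \<theta>_representer[OF assms(1)] assms(2) by metis

text \<open>
  For \<open>v = (Z\<^sub>i)\<^sub>i\<close> the representing vector has the same inner products with the selected columns as
  \<open>y\<close> does; so it is the projection of \<open>y\<close>.
\<close>

lemma proj_Z_eq_inner:
  assumes "invertible_mat (R_sub X is)"
  shows "proj_Z X y is j = signed_column X j \<bullet> orth_projection (selected_span X is) y"
proof -
  let ?U = "selected_span X is"
  obtain w where w: "w \<in> ?U"
    and ww: "\<And>b. b < length is \<Longrightarrow> signed_column X (is ! b) \<bullet> w = signed_column X (is ! b) \<bullet> y"
    and pr: "\<And>j. proj_Z X y is j = signed_column X j \<bullet> w"
    using regress_representer[OF assms, of "Matrix.vec (length is) (\<lambda>a. Zvec X y $ (is ! a))"]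
    by (auto simp: proj_Z_def Zvec_eq_inner)
  have "w = orth_projection ?U y"
  proof (rule eq_if_inner_eq_on_span)
    show "w \<in> span (signed_column X ` set is)" "orth_projection ?U y \<in> span (signed_column X ` set is)"
      using w orth_projection_in[OF subspace_selected_span[of X "is"], of y]
      by (simp_all add: selected_span_eq)
    fix b assume "b \<in> signed_column X ` set is"
    then obtain a where a: "a < length is" "b = signed_column X (is ! a)"
      by (auto simp: in_set_conv_nth)
    have "b \<bullet> orth_residual ?U y = 0"
      using orth_residual_orth[OF subspace_selected_span, of b X "is" y] a
      by (simp add: signed_column_in_selected_span inner_commute)
    then show "b \<bullet> w = b \<bullet> orth_projection ?U y"
      using ww[OF a(1)] a by (simp add: orth_residual_def inner_diff_right)
  qed
  then show ?thesis by (simp add: pr)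
qed

lemma frozen_eq_inner:
  assumes "invertible_mat (R_sub X is)"
  shows "frozen X y is j
    = (orth_residual (selected_span X is) (signed_column X j) \<bullet> y) / (1 - \<theta> X is j)"
  using orth_residual_self_adjoint[OF subspace_selected_span, of X "is" "signed_column X j" y]
  by (simp add: frozen_def proj_Z_eq_inner[OF assms] Zvec_eq_inner orth_residual_def inner_diff_right)

text \<open>
  The part of a new signed column that is not explained by the columns selected before it.
\<close>

definition innovation :: "real^'p^'n \<Rightarrow> ('p + 'p) list \<Rightarrow> 'p + 'p \<Rightarrow> real^'n" where
  "innovation X is i = orth_residual (selected_span X is) (signed_column X i)"

text \<open>
  With an invertible matrix every right-hand side can be prescribed.  The one that is 1 at the new
  index and 0 before gives a vector orthogonal to the earlier columns but not to the new one.
\<close>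

lemma innovation_nonzero:
  assumes "invertible_mat (R_sub X (is @ [i]))"
  shows "innovation X is i \<noteq> 0"
proof
  assume 0: "innovation X is i = 0"
  have in_span: "signed_column X i \<in> selected_span X is"
    using 0 orth_projection_in[OF subspace_selected_span[of X "is"], of "signed_column X i"]
    by (simp add: innovation_def orth_residual_def)
  let ?v = "Matrix.vec (Suc (length is)) (\<lambda>b. if b = length is then 1 else 0 :: real)"
  have "dim_vec ?v = length (is @ [i])" by simp
  then obtain w where w: "\<And>b. b < length (is @ [i]) \<Longrightarrow>
      signed_column X ((is @ [i]) ! b) \<bullet> w = Matrix.vec_index ?v b"
    using regress_representer[OF assms] by metis
  have "real_inner_class.orthogonal w z" if "z \<in> selected_span X is" for z
  proof (rule orthogonal_to_span[of z "signed_column X ` set is"])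
    show "z \<in> span (signed_column X ` set is)" using that by (simp add: selected_span_eq)
    fix b assume "b \<in> signed_column X ` set is"
    then obtain a where "a < length is" "b = signed_column X (is ! a)"
      by (auto simp: in_set_conv_nth)
    then show "real_inner_class.orthogonal w b"
      using w[of a] by (simp add: nth_append real_inner_class.orthogonal_def inner_commute)
  qed
  from this[OF in_span] show False
    using w[of "length is"] by (simp add: real_inner_class.orthogonal_def inner_commute)
qed

lemma orth_residual_snoc:
  "orth_residual (selected_span X (is @ [i])) y
    = orth_residual (selected_span X is) y
      - ((innovation X is i \<bullet> y) / (innovation X is i \<bullet> innovation X is i)) *\<^sub>R innovation X is i"
  unfolding selected_span_snoc innovation_def
  by (rule orth_residual_insert[OF subspace_selected_span])

text \<open>
  The vector with inner product 1 with all selected columns moves along the innovation \<open>u\<close>, which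
  leaves the inner products with the earlier columns alone; the step length \<open>(1 - \<theta>\<^sub>i) / (u \<bullet> u)\<close> is
  forced by the new column.
\<close>

lemma \<theta>_snoc:
  assumes inv: "invertible_mat (R_sub X is)" and inv': "invertible_mat (R_sub X (is @ [i]))"
  defines "u \<equiv> innovation X is i"
  shows "\<theta> X (is @ [i]) j = \<theta> X is j + (1 - \<theta> X is i) * ((u \<bullet> signed_column X j) / (u \<bullet> u))"
proof -
  let ?U = "selected_span X is"
  let ?V = "selected_span X (is @ [i])"
  let ?c = "(1 - \<theta> X is i) / (u \<bullet> u)"
  obtain w where w: "w \<in> ?U" "\<And>i. i \<in> set is \<Longrightarrow> signed_column X i \<bullet> w = 1"
    "\<And>j. \<theta> X is j = signed_column X j \<bullet> w"
    using \<theta>_representer[OF inv] by blast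
  obtain w' where w': "w' \<in> ?V" "\<And>k. k \<in> set (is @ [i]) \<Longrightarrow> signed_column X k \<bullet> w' = 1"
    "\<And>j. \<theta> X (is @ [i]) j = signed_column X j \<bullet> w'"
    using \<theta>_representer[OF inv'] by blast
  have u0: "u \<bullet> u \<noteq> 0" using innovation_nonzero[OF inv'] by (simp add: u_def)
  have uU: "u \<bullet> z = 0" if "z \<in> ?U" for z
    using orth_residual_orth[OF subspace_selected_span that] by (simp add: u_def innovation_def)
  have "?U \<subseteq> ?V" unfolding selected_span_snoc by (auto intro: span_base)
  have xi: "signed_column X i = orth_projection ?U (signed_column X i) + u"
    by (simp add: u_def innovation_def orth_residual_def)
  have Pi: "orth_projection ?U (signed_column X i) \<in> ?U"
    by (simp add: orth_projection_in subspace_selected_span)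
  have uxi: "signed_column X i \<bullet> u = u \<bullet> u"
    using uU[OF Pi] by (subst inner_commute, subst xi) (simp add: inner_add_right)
  have "u \<in> ?V"
    unfolding u_def innovation_def orth_residual_def
    using Pi \<open>?U \<subseteq> ?V\<close>
    by (intro subspace_diff subspace_selected_span signed_column_in_selected_span) auto
  have "w' = w + ?c *\<^sub>R u"
  proof (rule eq_if_inner_eq_on_span)
    show "w' \<in> span (signed_column X ` set (is @ [i]))"
      using w'(1) by (simp only: selected_span_eq)
    have "w + ?c *\<^sub>R u \<in> ?V"
      using w(1) \<open>?U \<subseteq> ?V\<close> \<open>u \<in> ?V\<close>
      by (intro subspace_add subspace_scale subspace_selected_span) auto
    then show "w + ?c *\<^sub>R u \<in> span (signed_column X ` set (is @ [i]))"
      by (simp only: selected_span_eq)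
    fix b assume "b \<in> signed_column X ` set (is @ [i])"
    then obtain k where k: "k \<in> set (is @ [i])" "b = signed_column X k" by blast
    show "b \<bullet> w' = b \<bullet> (w + ?c *\<^sub>R u)"
    proof (cases "k \<in> set is")
      case True
      then have "signed_column X k \<bullet> u = 0"
        using uU[OF signed_column_in_selected_span] by (simp add: inner_commute)
      then show ?thesis using True w(2) w'(2)[OF k(1)] k(2) by (simp add: inner_add_right)
    next
      case False
      then have "k = i" using k by simp
      then show ?thesis
        using w'(2)[OF k(1)] k(2) w(3)[of i] uxi u0 by (simp add: inner_add_right)
    qed
  qed
  then show ?thesis using w(3)[of j] w'(3)[of j] by (simp add: inner_add_right inner_commute)
qed

text \<open>
  The heart of the selection events.  The new quotient is \<open>(N\<^sub>j - \<rho> N\<^sub>i) / (d\<^sub>j - \<rho> d\<^sub>i)\<close>; comparing it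
  with \<open>N\<^sub>i / d\<^sub>i\<close> and clearing the positive denominators, the terms with \<open>\<rho>\<close> cancel on both sides and
  the comparison of \<open>N\<^sub>j / d\<^sub>j\<close> with \<open>N\<^sub>i / d\<^sub>i\<close> is left.
\<close>

lemma frozen_snoc_le_iff:
  assumes inv: "invertible_mat (R_sub X is)" and inv': "invertible_mat (R_sub X (is @ [i]))"
    and i: "\<theta> X is i < 1" and j: "\<theta> X is j < 1" and j': "\<theta> X (is @ [i]) j < 1"
  shows "frozen X y (is @ [i]) j \<le> frozen X y is i \<longleftrightarrow> frozen X y is j \<le> frozen X y is i"
proof -
  define u where "u = innovation X is i"
  define N where "N = (\<lambda>j. orth_residual (selected_span X is) (signed_column X j) \<bullet> y)"
  define \<rho> where "\<rho> = (u \<bullet> signed_column X j) / (u \<bullet> u)"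
  let ?d = "\<lambda>j. 1 - \<theta> X is j"
  let ?d' = "1 - \<theta> X (is @ [i]) j"
  have d': "?d' = ?d j - \<rho> * ?d i"
    using \<theta>_snoc[OF inv inv', of j] by (simp add: \<rho>_def u_def mult.commute)
  have "orth_residual (selected_span X (is @ [i])) (signed_column X j) \<bullet> y = N j - \<rho> * N i"
    unfolding orth_residual_snoc
    by (simp add: N_def \<rho>_def u_def inner_diff_left) (simp add: innovation_def)
  then have Z': "frozen X y (is @ [i]) j * ?d' = N j - \<rho> * N i"
    using j' by (simp add: frozen_eq_inner[OF inv'])
  have Zj: "frozen X y is j * ?d j = N j" and Zi: "frozen X y is i * ?d i = N i"
    using i j by (simp_all add: frozen_eq_inner[OF inv] N_def)
  have "frozen X y (is @ [i]) j \<le> frozen X y is i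
      \<longleftrightarrow> frozen X y (is @ [i]) j * ?d' \<le> frozen X y is i * ?d'"
    using j' by simp
  also have "\<dots> \<longleftrightarrow> frozen X y is j * ?d j - \<rho> * (frozen X y is i * ?d i)
      \<le> frozen X y is i * (?d j - \<rho> * ?d i)"
    using Z' by (simp only: Zi Zj d')
  also have "\<dots> \<longleftrightarrow> frozen X y is j * ?d j \<le> frozen X y is i * ?d j"
    by (simp add: algebra_simps)
  also have "\<dots> \<longleftrightarrow> frozen X y is j \<le> frozen X y is i"
    using j by simp
  finally show ?thesis .
qed

text \<open>
  Two frozen variables that are the same linear functional of the data would give
  \<open>\<rho> = (1 - \<theta>\<^sub>j) / (1 - \<theta>\<^sub>i)\<close>, and then the step that adds \<open>i\<close> would raise \<open>\<theta>\<^sub>j\<close> to 1.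
\<close>

lemma frozen_direction_inj:
  assumes inv: "invertible_mat (R_sub X is)" and inv': "invertible_mat (R_sub X (is @ [i]))"
    and i: "\<theta> X is i < 1" and j: "\<theta> X is j < 1" and j': "\<theta> X (is @ [i]) j \<noteq> 1"
  shows "(1 / (1 - \<theta> X is j)) *\<^sub>R innovation X is j \<noteq> (1 / (1 - \<theta> X is i)) *\<^sub>R innovation X is i"
proof
  assume eq: "(1 / (1 - \<theta> X is j)) *\<^sub>R innovation X is j = (1 / (1 - \<theta> X is i)) *\<^sub>R innovation X is i"
  define u where "u = innovation X is i"
  let ?U = "selected_span X is"
  have u0: "u \<bullet> u \<noteq> 0" using innovation_nonzero[OF inv'] by (simp add: u_def)
  have "innovation X is j = (1 - \<theta> X is j) *\<^sub>R ((1 / (1 - \<theta> X is j)) *\<^sub>R innovation X is j)"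
    using j by simp
  also have "\<dots> = ((1 - \<theta> X is j) / (1 - \<theta> X is i)) *\<^sub>R u"
    unfolding eq by (simp add: u_def)
  finally have inn: "innovation X is j = ((1 - \<theta> X is j) / (1 - \<theta> X is i)) *\<^sub>R u" .
  have "u \<bullet> orth_projection ?U (signed_column X j) = 0"
    using orth_residual_orth[OF subspace_selected_span orth_projection_in[OF subspace_selected_span]]
    by (simp add: u_def innovation_def)
  then have "u \<bullet> signed_column X j = u \<bullet> innovation X is j"
    by (simp add: innovation_def orth_residual_def inner_diff_right)
  then have "(u \<bullet> signed_column X j) / (u \<bullet> u) = (1 - \<theta> X is j) / (1 - \<theta> X is i)"
    using u0 by (simp add: inn)
  then have "\<theta> X (is @ [i]) j = 1"
    using \<theta>_snoc[OF inv inv', of j] i by (simp add: u_def)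
  then show False using j' by simp
qed

section \<open>Gaussian vectors\<close>

lemma nn_integral_lborel_translate:
  fixes f :: "'a::euclidean_space \<Rightarrow> ennreal"
  assumes [measurable]: "f \<in> borel_measurable borel"
  shows "(\<integral>\<^sup>+x. f (a + x) \<partial>lborel) = (\<integral>\<^sup>+x. f x \<partial>lborel)"
  by (subst (2) lborel_distr_plus[of a, symmetric]) (simp add: nn_integral_distr)

lemma nn_integral_lborel_reflect:
  fixes f :: "'a::euclidean_space \<Rightarrow> ennreal"
  assumes [measurable]: "f \<in> borel_measurable borel"
  shows "(\<integral>\<^sup>+x. f (- x) \<partial>lborel) = (\<integral>\<^sup>+x. f x \<partial>lborel)"
  by (subst (2) lborel_affine[of "-1" 0]) (simp_all add: nn_integral_density nn_integral_distr)

text \<open>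
  Both the integral of \<open>f\<close> and that of \<open>f \<circ> T\<close> are translation invariant, hence proportional.  To see
  this, multiply the integral of \<open>f \<circ> T\<close> by that of a test function \<open>g\<close> and exchange the order of
  integration around a translation; the two integrals of \<open>f\<close> then appear with factors \<open>\<integral>g\<close> and
  \<open>\<integral>g \<circ> T\<close>.  These factors agree when \<open>g\<close> is the indicator of the unit ball, which \<open>T\<close> preserves.
\<close>

lemma nn_integral_lborel_orthogonal_transformation:
  fixes T :: "'a::euclidean_space \<Rightarrow> 'a" and f :: "'a \<Rightarrow> ennreal"
  assumes T: "orthogonal_transformation T" and f[measurable]: "f \<in> borel_measurable borel"
  shows "(\<integral>\<^sup>+x. f (T x) \<partial>lborel) = (\<integral>\<^sup>+x. f x \<partial>lborel)"
proof -
  have lin: "linear T" by (rule orthogonal_transformation_linear[OF T])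
  have [measurable]: "T \<in> borel_measurable borel"
    by (intro borel_measurable_continuous_onI linear_continuous_on linear_conv_bounded_linear[THEN iffD1] lin)
  define g :: "'a \<Rightarrow> ennreal" where "g = indicator (ball 0 1)"
  have [measurable]: "g \<in> borel_measurable borel" 
    by (auto simp: g_def intro!: borel_measurable_indicator borel_open)
  have gT: "g (T x) = g x" for x
    by (simp add: g_def indicator_def orthogonal_transformation_norm[OF T])
  let ?F = "\<integral>\<^sup>+x. f (T x) \<partial>lborel" and ?G = "\<integral>\<^sup>+x. g x \<partial>lborel"
  have "?F * ?G = (\<integral>\<^sup>+x. (\<integral>\<^sup>+y. f (T x) * g y \<partial>lborel) \<partial>lborel)"
    by (simp add: nn_integral_cmult nn_integral_multc)
  also have "\<dots> = (\<integral>\<^sup>+x. (\<integral>\<^sup>+y. f (T x) * g (T x + y) \<partial>lborel) \<partial>lborel)"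
    by (simp add: nn_integral_cmult nn_integral_lborel_translate)
  also have "\<dots> = (\<integral>\<^sup>+y. (\<integral>\<^sup>+x. f (T x) * g (T x + y) \<partial>lborel) \<partial>lborel)"
    by (rule lborel_pair.Fubini') simp
  also have "\<dots> = (\<integral>\<^sup>+y. (\<integral>\<^sup>+x. f (T x - y) * g (T x) \<partial>lborel) \<partial>lborel)"
  proof (rule nn_integral_cong)
    fix y
    obtain z where z: "T z = y"
      using orthogonal_transformation_surj[OF T] by (metis surjD)
    have "(\<integral>\<^sup>+x. f (T x - y) * g (T x) \<partial>lborel) = (\<integral>\<^sup>+x. f (T (z + x) - y) * g (T (z + x)) \<partial>lborel)"
      by (rule nn_integral_lborel_translate[symmetric]) simp
    then show "(\<integral>\<^sup>+x. f (T x) * g (T x + y) \<partial>lborel) = (\<integral>\<^sup>+x. f (T x - y) * g (T x) \<partial>lborel)"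
      by (simp add: linear_add[OF lin] z add.commute)
  qed
  also have "\<dots> = (\<integral>\<^sup>+x. (\<integral>\<^sup>+y. f (T x - y) * g (T x) \<partial>lborel) \<partial>lborel)"
    by (rule lborel_pair.Fubini'[symmetric]) simp
  also have "\<dots> = (\<integral>\<^sup>+x. (\<integral>\<^sup>+y. f y \<partial>lborel) * g x \<partial>lborel)"
  proof (rule nn_integral_cong)
    fix x
    have "(\<integral>\<^sup>+y. f (T x - y) * g (T x) \<partial>lborel) = (\<integral>\<^sup>+y. f (T x + - y) \<partial>lborel) * g x"
      by (simp add: nn_integral_multc gT)
    also have "(\<integral>\<^sup>+y. f (T x + - y) \<partial>lborel) = (\<integral>\<^sup>+y. f (T x + y) \<partial>lborel)"
      by (rule nn_integral_lborel_reflect) simp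
    also have "\<dots> = (\<integral>\<^sup>+y. f y \<partial>lborel)"
      by (rule nn_integral_lborel_translate) simp
    finally show "(\<integral>\<^sup>+y. f (T x - y) * g (T x) \<partial>lborel) = (\<integral>\<^sup>+y. f y \<partial>lborel) * g x" .
  qed
  also have "\<dots> = (\<integral>\<^sup>+y. f y \<partial>lborel) * ?G"
    by (simp add: nn_integral_cmult)
  finally have "?F * ?G = (\<integral>\<^sup>+y. f y \<partial>lborel) * ?G" .
  moreover have "?G \<noteq> 0" "?G \<noteq> \<infinity>"
    using emeasure_lborel_ball_finite[of "0::'a" 1] content_ball_pos[of 1 "0::'a"]
    by (auto simp: g_def emeasure_eq_ennreal_measure)
  ultimately show ?thesis
    by (simp add: mult.commute[of _ ?G] ennreal_mult_cancel_left)
qed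

definition gaussian_density :: "real \<Rightarrow> real^'n \<Rightarrow> real" where
  "gaussian_density \<sigma> x = (\<Prod>a\<in>UNIV. normal_density 0 \<sigma> (x $ a))"

lemma gaussian_density_eq:
  fixes x :: "real^'n"
  shows "gaussian_density \<sigma> x
    = (1 / sqrt (2 * pi * \<sigma>\<^sup>2)) ^ CARD('n) * exp (- (norm x)\<^sup>2 / (2 * \<sigma>\<^sup>2))"
proof -
  have "(\<Sum>a\<in>UNIV. - (x $ a)\<^sup>2 / (2 * \<sigma>\<^sup>2)) = - (norm x)\<^sup>2 / (2 * \<sigma>\<^sup>2)"
    by (simp add: power2_norm_eq_inner inner_vec_def sum_divide_distrib[symmetric] sum_negf)
      (simp add: power2_eq_square)
  then have "exp (- (norm x)\<^sup>2 / (2 * \<sigma>\<^sup>2)) = (\<Prod>a\<in>UNIV. exp (- (x $ a)\<^sup>2 / (2 * \<sigma>\<^sup>2)))"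
    by (metis exp_sum finite)
  then show ?thesis
    unfolding gaussian_density_def normal_density_def prod.distrib by simp
qed

lemma borel_measurable_gaussian_density[measurable]: "gaussian_density \<sigma> \<in> borel_measurable borel"
  unfolding gaussian_density_def by measurable

lemma
  assumes "gaussian_noise M \<sigma> \<eta>"
  shows gaussian_noise_distributed: "distributed M lborel \<eta> (\<lambda>x. ennreal (gaussian_density \<sigma> x))"
    and gaussian_noise_measurable: "\<eta> \<in> borel_measurable M"
proof -
  show d: "distributed M lborel \<eta> (\<lambda>x. ennreal (gaussian_density \<sigma> x))"
    using assms by (simp add: gaussian_noise_def gaussian_density_def)
  show "\<eta> \<in> borel_measurable M"
    using distributed_measurable[OF d] by simp
qed

text \<open>A vector with a density almost surely avoids every Lebesgue null set.\<close>

lemma AE_gaussian_not_in_hyperplane: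
  assumes G: "gaussian_noise M \<sigma> \<eta>" and v: "v \<noteq> 0"
  shows "AE \<omega> in M. v \<bullet> \<eta> \<omega> \<noteq> c"
proof -
  have "{x. v \<bullet> x = c} \<in> null_sets lebesgue"
    using negligible_hyperplane[of v c] v by (simp add: negligible_iff_null_sets)
  then have "AE x in lebesgue. v \<bullet> x \<noteq> c"
    by (rule AE_I') auto
  then have "AE x in lborel. v \<bullet> x \<noteq> c"
    by (simp only: AE_completion_iff)
  then have "AE x in density lborel (\<lambda>x. ennreal (gaussian_density \<sigma> x)). v \<bullet> x \<noteq> c"
    by (subst AE_density) auto
  then have "AE x in distr M lborel \<eta>. v \<bullet> x \<noteq> c"
    by (simp only: distributed_distr_eq_density[OF gaussian_noise_distributed[OF G]])
  then show ?thesis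
    by (rule AE_distrD[rotated]) (use gaussian_noise_measurable[OF G] in simp)
qed

lemma borel_measurable_vecI:
  fixes f :: "'a \<Rightarrow> real^'n"
  assumes "\<And>a. (\<lambda>x. f x $ a) \<in> borel_measurable M"
  shows "f \<in> borel_measurable M"
  using assms by (subst borel_measurable_euclidean_space) (auto simp: Basis_vec_def inner_axis)

lemma orthonormal_coordinates_orthogonal_transformation:
  fixes e :: "'n \<Rightarrow> real^'n"
  assumes e: "\<And>a b. e a \<bullet> e b = (if a = b then 1 else 0)"
  shows "orthogonal_transformation (\<lambda>x. \<chi> a. e a \<bullet> x)"
proof -
  define A :: "real^'n^'n" where "A = (\<chi> a. e a)"
  have A: "(\<lambda>x. \<chi> a. e a \<bullet> x) = (*v) A"
    by (simp add: fun_eq_iff A_def matrix_vector_mult_def inner_vec_def vec_eq_iff)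
  have row: "Finite_Cartesian_Product.row a A = e a" for a
    by (simp add: A_def Finite_Cartesian_Product.row_def vec_eq_iff)
  have "orthogonal_matrix A"
    unfolding orthogonal_matrix_orthonormal_rows row
    by (simp add: real_inner_class.orthogonal_def e norm_eq_sqrt_inner)
  then show ?thesis
    by (simp add: orthogonal_transformation_matrix A matrix_vector_mul_linear matrix_of_matrix_vector_mul)
qed

text \<open>
  Passing to another orthonormal basis changes neither the density, a function of the norm, nor
  Lebesgue measure.  This lets the independence proofs choose the basis.
\<close>

lemma gaussian_noise_orthonormal_coordinates:
  fixes e :: "'n \<Rightarrow> real^'n"
  assumes G: "gaussian_noise M \<sigma> \<eta>" and e: "\<And>a b. e a \<bullet> e b = (if a = b then 1 else 0)"
  shows "gaussian_noise M \<sigma> (\<lambda>\<omega>. \<chi> a. e a \<bullet> \<eta> \<omega>)"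
proof -
  note [measurable] = gaussian_noise_measurable[OF G]
  define T :: "real^'n \<Rightarrow> real^'n" where "T x = (\<chi> a. e a \<bullet> x)" for x
  have T: "orthogonal_transformation T"
    unfolding T_def[abs_def] by (rule orthonormal_coordinates_orthogonal_transformation[OF e])
  have [measurable]: "T \<in> borel_measurable borel"
    unfolding T_def by (intro borel_measurable_vecI) simp
  have "distr M lborel (\<lambda>\<omega>. T (\<eta> \<omega>)) = density lborel (\<lambda>x. ennreal (gaussian_density \<sigma> x))"
  proof (rule measure_eqI)
    fix B assume "B \<in> sets (distr M lborel (\<lambda>\<omega>. T (\<eta> \<omega>)))"
    then have [measurable]: "B \<in> sets borel" by simp
    have "emeasure (distr M lborel (\<lambda>\<omega>. T (\<eta> \<omega>))) B = (\<integral>\<^sup>+\<omega>. indicator B (T (\<eta> \<omega>)) \<partial>M)"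
      using nn_integral_distr[of "\<lambda>\<omega>. T (\<eta> \<omega>)" M lborel "indicator B"] by simp
    also have "\<dots> = (\<integral>\<^sup>+x. ennreal (gaussian_density \<sigma> x) * indicator B (T x) \<partial>lborel)"
      by (rule distributed_nn_integral[OF gaussian_noise_distributed[OF G], symmetric]) simp
    also have "\<dots> = (\<integral>\<^sup>+x. ennreal (gaussian_density \<sigma> (T x)) * indicator B (T x) \<partial>lborel)"
      by (simp add: gaussian_density_eq orthogonal_transformation_norm[OF T])
    also have "\<dots> = (\<integral>\<^sup>+x. ennreal (gaussian_density \<sigma> x) * indicator B x \<partial>lborel)"
      by (rule nn_integral_lborel_orthogonal_transformation[OF T]) simp
    also have "\<dots> = emeasure (density lborel (\<lambda>x. ennreal (gaussian_density \<sigma> x))) B"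
      by (simp add: emeasure_density)
    finally show "emeasure (distr M lborel (\<lambda>\<omega>. T (\<eta> \<omega>))) B
        = emeasure (density lborel (\<lambda>x. ennreal (gaussian_density \<sigma> x))) B" .
  qed simp
  then show ?thesis
    unfolding gaussian_noise_def gaussian_density_def[symmetric] T_def[symmetric] distributed_def
    by (simp add: comp_def)
qed

lemma prod_Basis_vec: "(\<Prod>b\<in>(Basis :: (real^'n) set). f b) = (\<Prod>a\<in>UNIV. f (axis a 1))"
proof -
  have B: "(Basis :: (real^'n) set) = (\<lambda>a. axis a 1) ` UNIV" by (auto simp: Basis_vec_def)
  show ?thesis
    unfolding B by (subst prod.reindex) (auto simp: inj_on_def axis_eq_axis)
qed

lemma nn_integral_lborel_vec_prod:
  fixes f :: "'n::finite \<Rightarrow> real \<Rightarrow> ennreal"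
  assumes "\<And>a. f a \<in> borel_measurable borel"
  shows "(\<integral>\<^sup>+x. (\<Prod>a\<in>UNIV. f a (x $ a)) \<partial>(lborel :: (real^'n) measure))
    = (\<Prod>a\<in>UNIV. \<integral>\<^sup>+t. f a t \<partial>lborel)"
  using nn_integral_lborel_prod[of "\<lambda>b :: real^'n. f (axis_index b)"] assms
  by (simp add: prod_Basis_vec inner_axis)

text \<open>Density and Lebesgue measure are both products over the coordinates.\<close>

lemma emeasure_gaussian_box:
  fixes \<xi> :: "'w \<Rightarrow> real^'n"
  assumes G: "gaussian_noise M \<sigma> \<xi>" and A: "\<And>a. A a \<in> sets borel"
  shows "emeasure M {\<omega> \<in> space M. \<forall>a. \<xi> \<omega> $ a \<in> A a}
    = (\<Prod>a\<in>UNIV. emeasure (density lborel (\<lambda>t. ennreal (normal_density 0 \<sigma> t))) (A a))"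
proof -
  note [measurable] = A
  let ?B = "{x :: real^'n. \<forall>a. x $ a \<in> A a}"
  have B: "?B \<in> sets borel"
  proof -
    have "?B = (\<Inter>a. (\<lambda>x. x $ a) -` A a \<inter> space borel)" by auto
    also have "\<dots> \<in> sets borel"
      by (intro sets.finite_INT measurable_sets[OF _ A]) auto
    finally show ?thesis .
  qed
  have "emeasure M {\<omega> \<in> space M. \<forall>a. \<xi> \<omega> $ a \<in> A a} = emeasure M (\<xi> -` ?B \<inter> space M)"
    by (rule arg_cong[where f = "emeasure M"]) auto
  also have "\<dots> = (\<integral>\<^sup>+x. ennreal (gaussian_density \<sigma> x) * indicator ?B x \<partial>lborel)"
    using B by (intro distributed_emeasure[OF gaussian_noise_distributed[OF G]]) simp
  also have "\<dots> = (\<integral>\<^sup>+x. (\<Prod>a\<in>UNIV. ennreal (normal_density 0 \<sigma> (x $ a)) * indicator (A a) (x $ a)) \<partial>lborel)"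
  proof (rule nn_integral_cong)
    fix x :: "real^'n"
    have "(indicator ?B x :: ennreal) = (\<Prod>a\<in>UNIV. indicator (A a) (x $ a))"
      by (auto simp: indicator_def)
    then show "ennreal (gaussian_density \<sigma> x) * indicator ?B x
        = (\<Prod>a\<in>UNIV. ennreal (normal_density 0 \<sigma> (x $ a)) * indicator (A a) (x $ a))"
      by (simp add: gaussian_density_def prod.distrib prod_ennreal)
  qed
  also have "\<dots> = (\<Prod>a\<in>UNIV. \<integral>\<^sup>+t. ennreal (normal_density 0 \<sigma> t) * indicator (A a) t \<partial>lborel)"
    by (rule nn_integral_lborel_vec_prod[where f = "\<lambda>a t. ennreal (normal_density 0 \<sigma> t) * indicator (A a) t"])
       measurable
  finally show ?thesis by (simp add: emeasure_density)
qed

lemma gaussian_coordinates_indep: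
  fixes \<xi> :: "'w \<Rightarrow> real^'n"
  assumes "prob_space M" and \<sigma>: "\<sigma> > 0" and G: "gaussian_noise M \<sigma> \<xi>"
  shows "prob_space.indep_vars M (\<lambda>_. borel) (\<lambda>a \<omega>. \<xi> \<omega> $ a) UNIV"
proof -
  interpret prob_space M by fact
  have rv: "(\<lambda>\<omega>. \<xi> \<omega> $ a) \<in> borel_measurable M" for a
    by (rule measurable_compose[OF gaussian_noise_measurable[OF G]]) simp
  let ?N = "density lborel (\<lambda>t. ennreal (normal_density 0 \<sigma> t))"
  interpret N: prob_space ?N by (rule prob_space_normal_density[OF \<sigma>])
  \<comment> \<open>the box with a single proper side gives the distribution of one coordinate\<close>
  have marginal: "emeasure M ((\<lambda>\<omega>. \<xi> \<omega> $ a) -` B \<inter> space M) = emeasure ?N B"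
    if "B \<in> sets borel" for a B
  proof -
    have "(\<lambda>\<omega>. \<xi> \<omega> $ a) -` B \<inter> space M
        = {\<omega> \<in> space M. \<forall>b. \<xi> \<omega> $ b \<in> (if b = a then B else UNIV)}"
      by auto
    also have "emeasure M \<dots> = (\<Prod>b\<in>UNIV. emeasure ?N (if b = a then B else UNIV))"
      using that by (intro emeasure_gaussian_box[OF G]) auto
    also have "\<dots> = (\<Prod>b\<in>UNIV. if b = a then emeasure ?N B else 1)"
      using N.emeasure_space_1 by (intro prod.cong) auto
    finally show ?thesis by simp
  qed
  show ?thesis
  proof (subst indep_vars_finite[where E = "\<lambda>_. sets borel"])
    show "\<forall>A\<in>UNIV \<rightarrow> sets borel.
        prob (\<Inter>a. (\<lambda>\<omega>. \<xi> \<omega> $ a) -` A a \<inter> space M)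
        = (\<Prod>a\<in>UNIV. prob ((\<lambda>\<omega>. \<xi> \<omega> $ a) -` A a \<inter> space M))"
    proof
      fix A assume A: "A \<in> (UNIV :: 'n set) \<rightarrow> sets (borel :: real measure)"
      have "(\<Inter>a. (\<lambda>\<omega>. \<xi> \<omega> $ a) -` A a \<inter> space M) = {\<omega> \<in> space M. \<forall>a. \<xi> \<omega> $ a \<in> A a}"
        by auto
      also have "emeasure M \<dots> = (\<Prod>a\<in>UNIV. emeasure M ((\<lambda>\<omega>. \<xi> \<omega> $ a) -` A a \<inter> space M))"
        using A by (subst emeasure_gaussian_box[OF G]) (auto simp: marginal Pi_iff)
      finally show "prob (\<Inter>a. (\<lambda>\<omega>. \<xi> \<omega> $ a) -` A a \<inter> space M)
        = (\<Prod>a\<in>UNIV. prob ((\<lambda>\<omega>. \<xi> \<omega> $ a) -` A a \<inter> space M))"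
        by (simp add: emeasure_eq_measure prod_ennreal prod_nonneg)
    qed
  qed (auto simp: rv sets.Int_stable sets.sigma_sets_eq[of borel, simplified])
qed

text \<open>
  Events are described by Borel sets of \<open>real^'n\<close> that are insensitive to the coordinates outside a
  block.  This allows random elements of different types in one family of independent objects.
\<close>

definition depends_on :: "'n set \<Rightarrow> (real^'n \<Rightarrow> 'b) \<Rightarrow> bool" where
  "depends_on J f \<longleftrightarrow> (\<forall>x y. (\<forall>a\<in>J. x $ a = y $ a) \<longrightarrow> f x = f y)"

lemma gaussian_blocks_indep:
  fixes \<xi> :: "'w \<Rightarrow> real^'n"
  assumes "prob_space M" and "\<sigma> > 0" and G: "gaussian_noise M \<sigma> \<xi>" and disj: "disjoint_family_on J L"
  shows "prob_space.indep_sets M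
    (\<lambda>l. {\<xi> -` A \<inter> space M | A. A \<in> sets borel \<and> depends_on (J l) (\<lambda>x. x \<in> A)}) L"
proof -
  interpret prob_space M by fact
  let ?X = "\<lambda>l \<omega>. restrict (\<lambda>a. \<xi> \<omega> $ a) (J l)"
  have "indep_vars (\<lambda>l. Pi\<^sub>M (J l) (\<lambda>_. borel)) ?X L"
    by (rule indep_vars_restrict[OF gaussian_coordinates_indep[OF assms(1-3)]]) (use disj in auto)
  then have "indep_sets (\<lambda>l. {?X l -` A \<inter> space M | A. A \<in> sets (Pi\<^sub>M (J l) (\<lambda>_. borel))}) L"
    by (simp add: indep_vars_def2)
  then show ?thesis
  proof (rule indep_sets_mono_sets, safe)
    fix l A assume A: "A \<in> sets (borel :: (real^'n) measure)" and dep: "depends_on (J l) (\<lambda>x. x \<in> A)"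
    \<comment> \<open>fill up the coordinates outside the block with 0; by assumption the event does not notice\<close>
    define E where "E f = (\<chi> a. (if a \<in> J l then f a else 0))" for f :: "'n \<Rightarrow> real"
    have [measurable]: "E \<in> Pi\<^sub>M (J l) (\<lambda>_. borel) \<rightarrow>\<^sub>M borel"
      unfolding E_def
    proof (rule borel_measurable_vecI)
      fix a show "(\<lambda>f. (\<chi> a. if a \<in> J l then f a else 0) $ a) \<in> borel_measurable (Pi\<^sub>M (J l) (\<lambda>_. borel))"
        by (cases "a \<in> J l") simp_all
    qed
    let ?A = "E -` A \<inter> space (Pi\<^sub>M (J l) (\<lambda>_. borel))"
    have "E (?X l \<omega>) \<in> A \<longleftrightarrow> \<xi> \<omega> \<in> A" for \<omega>
      using dep unfolding depends_on_def by (auto simp: E_def)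
    then have "\<xi> -` A \<inter> space M = ?X l -` ?A \<inter> space M"
      by (auto simp: space_PiM)
    moreover have "?A \<in> sets (Pi\<^sub>M (J l) (\<lambda>_. borel))"
      using A by measurable
    ultimately show "\<exists>B. \<xi> -` A \<inter> space M = ?X l -` B \<inter> space M \<and> B \<in> sets (Pi\<^sub>M (J l) (\<lambda>_. borel))"
      by blast
  qed
qed

definition block_norm :: "'n set \<Rightarrow> real^'n \<Rightarrow> real" where
  "block_norm S x = sqrt (\<Sum>a\<in>S. (x $ a)\<^sup>2)"

definition block_scale :: "'n set \<Rightarrow> real \<Rightarrow> real^'n \<Rightarrow> real^'n" where
  "block_scale S t x = (\<chi> a. if a \<in> S then t * x $ a else x $ a)"

lemma borel_measurable_block_norm[measurable]: "block_norm S \<in> borel_measurable borel"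
  unfolding block_norm_def by measurable

lemma borel_measurable_block_scale[measurable]: "block_scale S t \<in> borel_measurable borel"
proof (rule borel_measurable_vecI)
  show "(\<lambda>x. block_scale S t x $ a) \<in> borel_measurable borel" for a
    by (cases "a \<in> S") (simp_all add: block_scale_def)
qed

lemma block_norm_block_scale:
  assumes "t > 0"
  shows "block_norm S (block_scale S t x) = t * block_norm S x"
  using assms
  by (simp add: block_norm_def block_scale_def power_mult_distrib sum_distrib_left[symmetric]
      real_sqrt_mult cong: sum.cong)

lemma nn_integral_block_scale:
  fixes S :: "'n::finite set" and f :: "real^'n \<Rightarrow> ennreal"
  assumes t: "t > 0" and [measurable]: "f \<in> borel_measurable borel"
  shows "(\<integral>\<^sup>+x. f x \<partial>lborel) = ennreal (t ^ card S) * (\<integral>\<^sup>+x. f (block_scale S t x) \<partial>lborel)"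
proof -
  define c where "c b = (if axis_index b \<in> S then t else 1)" for b :: "real^'n"
  have T: "0 + (\<Sum>j\<in>Basis. (c j * (x \<bullet> j)) *\<^sub>R j) = block_scale S t x" for x
  proof (rule euclidean_eqI)
    fix b :: "real^'n" assume b: "b \<in> Basis"
    then obtain a where a: "b = axis a 1" by (auto simp: Basis_vec_def)
    have "(0 + (\<Sum>j\<in>Basis. (c j * (x \<bullet> j)) *\<^sub>R j)) \<bullet> b = c b * (x \<bullet> b)"
      using b by (simp add: inner_sum_left inner_Basis if_distrib cong: if_cong)
    then show "(0 + (\<Sum>j\<in>Basis. (c j * (x \<bullet> j)) *\<^sub>R j)) \<bullet> b = block_scale S t x \<bullet> b"
      by (simp add: a c_def block_scale_def inner_axis)
  qed
  have prod_c: "(\<Prod>j\<in>Basis. \<bar>c j\<bar>) = t ^ card S"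
    using t by (simp add: prod_Basis_vec c_def if_distrib prod.If_cases cong: if_cong)
  have "(lborel :: (real^'n) measure) = density (distr lborel borel (block_scale S t)) (\<lambda>_. ennreal (t ^ card S))"
    using lborel_affine_euclidean[of c 0] t unfolding T prod_c by (simp add: c_def)
  then have "(\<integral>\<^sup>+x. f x \<partial>lborel)
      = (\<integral>\<^sup>+x. f x \<partial>density (distr lborel borel (block_scale S t)) (\<lambda>_. ennreal (t ^ card S)))"
    by simp
  then show ?thesis
    by (simp add: nn_integral_density nn_integral_distr nn_integral_cmult)
qed

text \<open>
  The independence of norm and direction of a Gaussian vector, with spectator coordinates outside
  \<open>S\<close>.  The density factors into \<open>h\<close>, a function of the coordinates outside \<open>S\<close>, and \<open>\<gamma>\<close>, a function of
  the norm \<open>r\<close> of the block.  Under the measure with density \<open>h\<close> restricted to an invariant \<open>E\<close>, the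
  mass of \<open>{r < t}\<close> is \<open>t\<close> to the power \<open>card S\<close> times the mass of \<open>{r < 1}\<close>; so the distribution \<open>\<nu> E\<close>
  of \<open>r\<close> depends on \<open>E\<close> only through a constant factor.  Integrating \<open>\<gamma>\<close> against it, the factor splits
  off from every event about \<open>r\<close>.
\<close>

lemma block_scale_invariant_indep_block_norm:
  fixes \<xi> :: "'w \<Rightarrow> real^'n" and S :: "'n set"
  assumes "prob_space M" and \<sigma>: "\<sigma> > 0" and G: "gaussian_noise M \<sigma> \<xi>"
    and E: "E \<in> sets borel" and inv: "\<And>t x. t > 0 \<Longrightarrow> block_scale S t x \<in> E \<longleftrightarrow> x \<in> E"
    and B: "B \<in> sets borel"
  shows "measure M {\<omega> \<in> space M. \<xi> \<omega> \<in> E \<and> block_norm S (\<xi> \<omega>) \<in> B}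
    = measure M {\<omega> \<in> space M. \<xi> \<omega> \<in> E} * measure M {\<omega> \<in> space M. block_norm S (\<xi> \<omega>) \<in> B}"
proof -
  interpret prob_space M by fact
  note [measurable] = gaussian_noise_measurable[OF G]
  let ?R = "block_norm S"
  define c where "c = (1 / sqrt (2 * pi * \<sigma>\<^sup>2)) ^ card S"
  define \<gamma> where "\<gamma> r = c * exp (- r\<^sup>2 / (2 * \<sigma>\<^sup>2))" for r :: real
  define h where "h x = (\<Prod>a\<in>-S. normal_density 0 \<sigma> (x $ a))" for x :: "real^'n"
  have "c > 0" using \<sigma> by (simp add: c_def)
  have \<gamma>: "\<gamma> r > 0" for r using \<open>c > 0\<close> by (simp add: \<gamma>_def)
  have h: "h x \<ge> 0" for x by (simp add: h_def prod_nonneg)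
  have [measurable]: "\<gamma> \<in> borel_measurable borel" "h \<in> borel_measurable borel"
    unfolding \<gamma>_def h_def by measurable
  have R0: "?R x \<ge> 0" for x by (simp add: block_norm_def sum_nonneg)
  have dens: "gaussian_density \<sigma> x = h x * \<gamma> (?R x)" for x
  proof -
    have "(\<Sum>a\<in>S. - (x $ a)\<^sup>2 / (2 * \<sigma>\<^sup>2)) = - (?R x)\<^sup>2 / (2 * \<sigma>\<^sup>2)"
      by (simp add: block_norm_def sum_nonneg sum_divide_distrib[symmetric] sum_negf)
    then have "exp (- (?R x)\<^sup>2 / (2 * \<sigma>\<^sup>2)) = (\<Prod>a\<in>S. exp (- (x $ a)\<^sup>2 / (2 * \<sigma>\<^sup>2)))"
      by (metis exp_sum finite)
    then have "(\<Prod>a\<in>S. normal_density 0 \<sigma> (x $ a)) = \<gamma> (?R x)"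
      unfolding normal_density_def prod.distrib by (simp add: \<gamma>_def c_def)
    moreover have "gaussian_density \<sigma> x
        = (\<Prod>a\<in>S. normal_density 0 \<sigma> (x $ a)) * (\<Prod>a\<in>-S. normal_density 0 \<sigma> (x $ a))"
      unfolding gaussian_density_def
      by (subst prod.union_disjoint[symmetric]) (auto intro: prod.cong)
    ultimately show ?thesis by (simp add: h_def)
  qed
  define \<nu> where "\<nu> E = distr (density lborel (\<lambda>x. ennreal (h x) * indicator E x)) borel ?R" for E
  have nn_\<nu>: "(\<integral>\<^sup>+r. f r \<partial>\<nu> E) = (\<integral>\<^sup>+x. ennreal (h x) * indicator E x * f (?R x) \<partial>lborel)"
    if [measurable]: "E \<in> sets borel" "f \<in> borel_measurable borel" for E f
    by (simp add: \<nu>_def nn_integral_distr nn_integral_density)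
  have \<nu>_ball: "emeasure (\<nu> E) A = (\<integral>\<^sup>+x. ennreal (h x) * indicator E x * indicator A (?R x) \<partial>lborel)"
    if [measurable]: "E \<in> sets borel" "A \<in> sets borel" for E A
    using nn_\<nu>[of E "indicator A"] that by (subst nn_integral_indicator[symmetric]) (simp_all add: \<nu>_def)
  \<comment> \<open>substitute \<open>x = block_scale S t y\<close>, which leaves \<open>h\<close> and \<open>E\<close> unchanged\<close>
  have scaling: "emeasure (\<nu> E) {..<t} = ennreal (t ^ card S) * emeasure (\<nu> E) {..<1}"
    if t: "t > 0" and [measurable]: "E \<in> sets borel"
      and inv: "\<And>x. block_scale S t x \<in> E \<longleftrightarrow> x \<in> E" for t E
  proof -
    have "emeasure (\<nu> E) {..<t} = (\<integral>\<^sup>+x. ennreal (h x) * indicator E x * indicator {..<t} (?R x) \<partial>lborel)"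
      by (rule \<nu>_ball) simp_all
    also have "\<dots> = ennreal (t ^ card S) *
        (\<integral>\<^sup>+x. ennreal (h (block_scale S t x)) * indicator E (block_scale S t x)
          * indicator {..<t} (?R (block_scale S t x)) \<partial>lborel)"
      by (rule nn_integral_block_scale[OF t]) measurable
    also have "(\<integral>\<^sup>+x. ennreal (h (block_scale S t x)) * indicator E (block_scale S t x)
          * indicator {..<t} (?R (block_scale S t x)) \<partial>lborel)
        = (\<integral>\<^sup>+x. ennreal (h x) * indicator E x * indicator {..<1} (?R x) \<partial>lborel)"
    proof (rule nn_integral_cong)
      fix x
      have "h (block_scale S t x) = h x"
        by (simp add: h_def block_scale_def)
      moreover have "t * ?R x < t \<longleftrightarrow> ?R x < 1" using t by simp
      ultimately show "ennreal (h (block_scale S t x)) * indicator E (block_scale S t x)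
            * indicator {..<t} (?R (block_scale S t x))
          = ennreal (h x) * indicator E x * indicator {..<1} (?R x)"
        using inv[of x] by (simp add: block_norm_block_scale[OF t] indicator_def)
    qed
    finally show ?thesis by (simp add: \<nu>_ball)
  qed
  have zero: "emeasure (\<nu> E) {..<t} = 0" if "t \<le> 0" and [measurable]: "E \<in> sets borel" for t E
  proof -
    have "indicator {..<t} (?R x) = (0 :: ennreal)" for x
      using R0[of x] that by (simp add: indicator_def)
    then show ?thesis by (simp add: \<nu>_ball)
  qed
  have total: "(\<integral>\<^sup>+r. ennreal (\<gamma> r) \<partial>\<nu> UNIV) = 1"
  proof -
    have "(\<integral>\<^sup>+r. ennreal (\<gamma> r) \<partial>\<nu> UNIV)
        = (\<integral>\<^sup>+x. ennreal (gaussian_density \<sigma> (x :: real^'n)) * indicator UNIV x \<partial>lborel)"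
      using h \<gamma>[THEN less_imp_le] by (subst nn_\<nu>) (simp_all add: dens ennreal_mult)
    also have "\<dots> = emeasure M (\<xi> -` UNIV \<inter> space M)"
      by (rule distributed_emeasure[OF gaussian_noise_distributed[OF G], symmetric]) simp
    finally show ?thesis by (simp add: emeasure_space_1)
  qed
  let ?m = "\<lambda>E. emeasure (\<nu> E) {..<1}"
  \<comment> \<open>on \<open>{r < 1}\<close> the factor \<open>\<gamma>\<close> is at least \<open>\<gamma> 1\<close>, so the mass is at most \<open>1 / \<gamma> 1\<close>\<close>
  have finite_U: "?m UNIV < \<infinity>"
  proof -
    have "ennreal (\<gamma> 1) * ?m UNIV = (\<integral>\<^sup>+r. ennreal (\<gamma> 1) * indicator {..<1} r \<partial>\<nu> UNIV)"
      by (subst nn_integral_cmult) (simp_all add: \<nu>_def)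
    also have "\<dots> = (\<integral>\<^sup>+x. ennreal (h x) * indicator UNIV x * (ennreal (\<gamma> 1) * indicator {..<1} (?R x)) \<partial>lborel)"
      by (rule nn_\<nu>) simp_all
    also have "\<dots> \<le> (\<integral>\<^sup>+x. ennreal (h x) * indicator UNIV x * ennreal (\<gamma> (?R x)) \<partial>lborel)"
    proof (intro nn_integral_mono mult_left_mono)
      fix x
      have "\<gamma> 1 \<le> \<gamma> (?R x)" if "?R x < 1"
        using that R0[of x] \<open>c > 0\<close> \<sigma> by (simp add: \<gamma>_def divide_right_mono power_le_one)
      then show "ennreal (\<gamma> 1) * indicator {..<1} (?R x) \<le> ennreal (\<gamma> (?R x))"
        by (auto simp: indicator_def intro: ennreal_leI)
    qed simp
    also have "\<dots> = 1" using total by (subst (asm) nn_\<nu>) simp_all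
    finally have le: "ennreal (\<gamma> 1) * ?m UNIV \<le> 1" .
    show ?thesis
    proof (rule ccontr)
      assume "\<not> ?m UNIV < \<infinity>"
      then have "?m UNIV = \<top>" by (simp add: less_top[symmetric])
      then show False using le \<gamma>[of 1] by (simp add: ennreal_mult_top top_unique)
    qed
  qed
  have finite_m: "?m E < \<infinity>"
  proof -
    have "?m E \<le> ?m UNIV"
      using E by (auto simp: \<nu>_ball indicator_def intro!: nn_integral_mono)
    then show ?thesis using finite_U by (rule le_less_trans)
  qed
  have nonzero: "?m UNIV \<noteq> 0"
  proof
    assume 0: "?m UNIV = 0"
    have "emeasure (\<nu> UNIV) {..<real n} = 0" for n
      using zero[of "real n" UNIV] scaling[of "real n" UNIV] 0 by (cases "n = 0") auto
    then have "emeasure (\<nu> UNIV) (\<Union>n. {..<real n}) = 0"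
      by (intro emeasure_UN_eq_0) (auto simp: \<nu>_def)
    also have "(\<Union>n. {..<real n}) = UNIV" by (auto intro: reals_Archimedean2)
    finally have "AE r in \<nu> UNIV. ennreal (\<gamma> r) = 0"
      by (intro AE_I[where N = UNIV]) (auto simp: \<nu>_def)
    then have "(\<integral>\<^sup>+r. ennreal (\<gamma> r) \<partial>\<nu> UNIV) = 0"
      by (subst nn_integral_0_iff_AE) (simp_all add: \<nu>_def)
    then show False using total by simp
  qed
  \<comment> \<open>open half-lines, unlike closed ones, carry no mass for \<open>t \<le> 0\<close>, so the origin needs no care\<close>
  have proportional: "scale_measure (?m UNIV) (\<nu> E) = scale_measure (?m E) (\<nu> UNIV)"
  proof (rule measure_eqI_generator_eq[where E = "range lessThan" and \<Omega> = UNIV and A = "\<lambda>n. {..<real n}"])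
    have "{..<a} \<inter> {..<b} = {..<min a b}" for a b :: real by auto
    then show "Int_stable (range (lessThan :: real \<Rightarrow> _))"
      by (auto simp: Int_stable_def)
    have "sets (borel :: real measure) = sigma_sets UNIV (range lessThan)"
      by (subst borel_Iio) simp
    then show "sets (scale_measure (?m UNIV) (\<nu> E)) = sigma_sets UNIV (range lessThan)"
      and "sets (scale_measure (?m E) (\<nu> UNIV)) = sigma_sets UNIV (range lessThan)"
      by (simp_all add: \<nu>_def)
    show "emeasure (scale_measure (?m UNIV) (\<nu> E)) A = emeasure (scale_measure (?m E) (\<nu> UNIV)) A"
      if "A \<in> range lessThan" for A
    proof -
      obtain t where A: "A = {..<t}" using \<open>A \<in> range lessThan\<close> by blast
      show ?thesis
      proof (cases "t > 0")
        case True
        then show ?thesis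
          using scaling[OF True E inv[OF True]] scaling[OF True, of UNIV] by (simp add: A ac_simps)
      next
        case False
        then show ?thesis using zero[of t E] zero[of t UNIV] E by (simp add: A)
      qed
    qed
    show "emeasure (scale_measure (?m UNIV) (\<nu> E)) {..<real n} \<noteq> \<infinity>" for n
      using zero[of "real n" E] scaling[of "real n" E] E inv finite_U finite_m
      by (cases "n = 0") (auto simp: ennreal_mult_eq_top_iff)
    show "(\<Union>n. {..<real n}) = UNIV" by (auto intro: reals_Archimedean2)
  qed auto
  define p where "p E B = (\<integral>\<^sup>+r. ennreal (\<gamma> r) * indicator B r \<partial>\<nu> E)" for E B
  have p: "emeasure M {\<omega> \<in> space M. \<xi> \<omega> \<in> E \<and> ?R (\<xi> \<omega>) \<in> B} = p E B"
    if [measurable]: "E \<in> sets borel" "B \<in> sets borel" for E B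
  proof -
    have "{\<omega> \<in> space M. \<xi> \<omega> \<in> E \<and> ?R (\<xi> \<omega>) \<in> B} = \<xi> -` (E \<inter> ?R -` B) \<inter> space M" by auto
    also have "emeasure M \<dots> = (\<integral>\<^sup>+x. ennreal (gaussian_density \<sigma> x) * indicator (E \<inter> ?R -` B) x \<partial>lborel)"
      using measurable_sets[of ?R borel borel B]
      by (intro distributed_emeasure[OF gaussian_noise_distributed[OF G]]) simp
    also have "\<dots> = (\<integral>\<^sup>+x. ennreal (h x) * indicator E x * (ennreal (\<gamma> (?R x)) * indicator B (?R x)) \<partial>lborel)"
      using h \<gamma>[THEN less_imp_le]
      by (intro nn_integral_cong) (simp add: dens ennreal_mult indicator_def)
    also have "\<dots> = p E B"
      unfolding p_def by (rule nn_\<nu>[symmetric]) simp_all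
    finally show ?thesis .
  qed
  have pm: "?m UNIV * p E B = ?m E * p UNIV B" if [measurable]: "B \<in> sets borel" for B
  proof -
    have "?m UNIV * p E B = (\<integral>\<^sup>+r. ennreal (\<gamma> r) * indicator B r \<partial>scale_measure (?m UNIV) (\<nu> E))"
      unfolding p_def by (rule nn_integral_scale_measure[symmetric]) (simp add: \<nu>_def)
    also have "\<dots> = ?m E * p UNIV B"
      unfolding proportional p_def by (rule nn_integral_scale_measure) (simp add: \<nu>_def)
    finally show ?thesis .
  qed
  \<comment> \<open>the choice \<open>B = UNIV\<close> identifies the factor as the probability of \<open>E\<close>\<close>
  have "p UNIV UNIV = 1" using total by (simp add: p_def)
  then have "?m UNIV * p E B = ?m UNIV * (p E UNIV * p UNIV B)"
    using pm[OF B] pm[of UNIV] by (simp add: mult.assoc[symmetric])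
  then have "p E B = p E UNIV * p UNIV B"
    using nonzero finite_U by (auto simp: ennreal_mult_cancel_left)
  then have "emeasure M {\<omega> \<in> space M. \<xi> \<omega> \<in> E \<and> ?R (\<xi> \<omega>) \<in> B}
      = emeasure M {\<omega> \<in> space M. \<xi> \<omega> \<in> E} * emeasure M {\<omega> \<in> space M. ?R (\<xi> \<omega>) \<in> B}"
    using p[OF E B] p[OF E, of UNIV] p[OF _ B, of UNIV] by simp
  then show ?thesis
    by (simp add: emeasure_eq_measure ennreal_mult[symmetric])
qed

section \<open>The LARS path\<close>

lemma pre_0: "pre i 0 = []"
  by (simp add: pre_def)

lemma pre_Suc: "pre i (Suc k) = pre i k @ [i (Suc k)]"
  by (simp add: pre_def)

lemma set_pre: "set (pre i k) = i ` {1..k}"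
  by (auto simp: pre_def simp del: upt_Suc)

lemma length_pre: "length (pre i k) = k"
  by (simp add: pre_def)

lemma take_pre: "l \<le> k \<Longrightarrow> take l (pre i k) = pre i l"
  by (simp add: pre_def take_map take_upt del: upt_Suc)

lemma pre_cong: "(\<And>l. l \<in> {1..k} \<Longrightarrow> i l = i' l) \<Longrightarrow> pre i k = pre i' k"
  by (auto simp: pre_def simp del: upt_Suc)

lemma distinct_pre_notin:
  assumes "pre i m \<in> signed_tuples m" "l < m"
  shows "i (Suc l) \<notin> set (pre i l)"
proof -
  have "distinct (map var (take (Suc l) (pre i m)))"
    using assms by (simp add: signed_tuples_def distinct_take take_map[symmetric])
  then show ?thesis
    using assms by (auto simp: take_pre pre_Suc)
qed

lemma lars_selection_mono: "lars_selection X y m \<iota> \<Longrightarrow> l \<le> m \<Longrightarrow> lars_selection X y l \<iota>"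
  by (auto simp: lars_selection_def)

lemma lars_selection_cong:
  assumes sel: "lars_selection X y m \<iota>" and eq: "\<And>l. l \<in> {1..m} \<Longrightarrow> \<iota> l = i l"
  shows "lars_selection X y m i"
  unfolding lars_selection_def
proof
  fix l assume l: "l \<in> {1..m}"
  then have "pre \<iota> (l - 1) = pre i (l - 1)" by (intro pre_cong eq) auto
  moreover have "frozen_argmax X y (pre \<iota> (l - 1)) (\<iota> l)"
    using sel l unfolding lars_selection_def by blast
  ultimately show "frozen_argmax X y (pre i (l - 1)) (i l)"
    using eq[OF l] by simp
qed

locale irrepresentable_path =
  fixes X :: "real^'p^'n" and i :: "nat \<Rightarrow> 'p + 'p" and K :: nat
  assumes check: "irrepresentable_check X (pre i K)"
    and tuple: "pre i (K + 1) \<in> signed_tuples (K + 1)"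
begin

lemma invertible_pre: "l \<le> K \<Longrightarrow> invertible_mat (R_sub X (pre i l))"
  using check invertible_R_sub_Nil
  by (cases "l = 0") (auto simp: irrepresentable_check_def length_pre take_pre pre_0)

lemma \<theta>_pre_less_1_iff: "l \<le> K \<Longrightarrow> \<theta> X (pre i l) j < 1 \<longleftrightarrow> j \<notin> set (pre i l)"
proof
  assume l: "l \<le> K"
  show "j \<notin> set (pre i l)" if "\<theta> X (pre i l) j < 1"
    using \<theta>_selected[OF invertible_pre[OF l], of j] that by auto
  show "\<theta> X (pre i l) j < 1" if "j \<notin> set (pre i l)"
    using check that l
    by (cases "l = 0") (auto simp: irrepresentable_check_def length_pre take_pre pre_0 \<theta>_Nil)
qed

lemma next_notin_pre: "l \<le> K \<Longrightarrow> i (Suc l) \<notin> set (pre i l)"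
  using distinct_pre_notin[OF tuple] by simp

lemma frozen_max_le_iff:
  assumes "l \<le> K"
  shows "frozen_max X y (pre i l) \<le> c \<longleftrightarrow> (\<forall>j. j \<notin> set (pre i l) \<longrightarrow> frozen X y (pre i l) j \<le> c)"
  unfolding frozen_max_def \<theta>_pre_less_1_iff[OF assms]
  using next_notin_pre[OF assms] by (subst Max_le_iff) auto

lemma frozen_at_le_max:
  assumes "l \<le> K"
  shows "frozen_at X y i (Suc l) \<le> frozen_max X y (pre i l)"
  using frozen_max_le_iff[OF assms, of y "frozen_max X y (pre i l)"] next_notin_pre[OF assms]
  by (simp add: frozen_at_def)

lemma frozen_argmax_iff:
  assumes "l \<le> K"
  shows "frozen_argmax X y (pre i l) (i (Suc l)) \<longleftrightarrow> frozen_max X y (pre i l) = frozen_at X y i (Suc l)"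
proof -
  have "frozen_argmax X y (pre i l) (i (Suc l)) \<longleftrightarrow> frozen_max X y (pre i l) \<le> frozen_at X y i (Suc l)"
    unfolding frozen_argmax_def is_arg_max_def \<theta>_pre_less_1_iff[OF assms] frozen_max_le_iff[OF assms]
    using next_notin_pre[OF assms] by (auto simp: frozen_at_def not_less)
  then show ?thesis
    using frozen_at_le_max[OF assms, of y] by auto
qed

text \<open>
  Passing from \<open>l\<close> to \<open>l + 1\<close> indices removes only the new index from the range of the maximum, and
  for the other indices the comparison with \<open>Z\<close> at the new index is the same before and after.
\<close>

lemma frozen_max_next_le_iff:
  assumes "l < K"
  shows "frozen_max X y (pre i (Suc l)) \<le> frozen_at X y i (Suc l)
    \<longleftrightarrow> frozen_argmax X y (pre i l) (i (Suc l))"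
proof -
  have l: "l \<le> K" "Suc l \<le> K" using assms by simp_all
  let ?Z = "frozen X y (pre i l)" and ?Z' = "frozen X y (pre i (Suc l))"
  have iff: "?Z' j \<le> ?Z (i (Suc l)) \<longleftrightarrow> ?Z j \<le> ?Z (i (Suc l))" if "j \<notin> set (pre i (Suc l))" for j
    using frozen_snoc_le_iff[of X "pre i l" "i (Suc l)" j y] that next_notin_pre[OF l(1)]
      invertible_pre[OF l(1)] invertible_pre[OF l(2)]
      \<theta>_pre_less_1_iff[OF l(1)] \<theta>_pre_less_1_iff[OF l(2), of j]
    by (simp add: pre_Suc)
  have "frozen_max X y (pre i (Suc l)) \<le> frozen_at X y i (Suc l)
      \<longleftrightarrow> (\<forall>j. j \<notin> set (pre i (Suc l)) \<longrightarrow> ?Z j \<le> ?Z (i (Suc l)))"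
    by (simp add: frozen_max_le_iff[OF l(2)] frozen_at_def iff)
  also have "\<dots> \<longleftrightarrow> (\<forall>j. j \<notin> set (pre i l) \<longrightarrow> ?Z j \<le> ?Z (i (Suc l)))"
    by (simp add: pre_Suc) (metis order_refl)
  also have "\<dots> \<longleftrightarrow> frozen_argmax X y (pre i l) (i (Suc l))"
    unfolding frozen_argmax_def is_arg_max_def \<theta>_pre_less_1_iff[OF l(1)]
    using next_notin_pre[OF l(1)] by (auto simp: not_less)
  finally show ?thesis .
qed

text \<open>
  Reading the chain backwards: if the maximum after \<open>l\<close> steps is at most \<open>Z\<close> at \<open>i\<^sub>l\<close>, then \<open>i\<^sub>l\<close> attained
  the maximum before, so this earlier maximum equals \<open>Z\<close> at \<open>i\<^sub>l\<close> and the next inequality of the chain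
  bounds it by \<open>Z\<close> at \<open>i\<^sub>l\<^sub>-\<^sub>1\<close>.
\<close>

lemma lars_selection_iff_max_le:
  assumes "1 \<le> k" "k \<le> K"
  shows "lars_selection X y k i \<longleftrightarrow>
    frozen_max X y (pre i k) \<le> frozen_at X y i k \<and>
    (\<forall>l\<in>{1..<k}. frozen_at X y i (l + 1) \<le> frozen_at X y i l)"
proof
  assume sel: "lars_selection X y k i"
  have max_le: "frozen_max X y (pre i l) \<le> frozen_at X y i l" if "l \<in> {1..k}" for l
    using frozen_max_next_le_iff[of "l - 1" y] sel that assms by (auto simp: lars_selection_def)
  have "frozen_at X y i (l + 1) \<le> frozen_at X y i l" if "l \<in> {1..<k}" for l
    using frozen_at_le_max[of l y] max_le[of l] that assms by auto
  then show "frozen_max X y (pre i k) \<le> frozen_at X y i k \<and>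
      (\<forall>l\<in>{1..<k}. frozen_at X y i (l + 1) \<le> frozen_at X y i l)"
    using max_le[of k] assms by simp
next
  assume chain: "frozen_max X y (pre i k) \<le> frozen_at X y i k \<and>
    (\<forall>l\<in>{1..<k}. frozen_at X y i (l + 1) \<le> frozen_at X y i l)"
  have max_le: "1 \<le> l \<Longrightarrow> frozen_max X y (pre i l) \<le> frozen_at X y i l" if "l \<le> k" for l
    using that
  proof (induction rule: inc_induct)
    case base
    show ?case using chain by simp
  next
    case (step l)
    then have "frozen_argmax X y (pre i l) (i (Suc l))"
      using frozen_max_next_le_iff[of l y] assms by simp
    then have "frozen_max X y (pre i l) = frozen_at X y i (Suc l)"
      using frozen_argmax_iff[of l y] step assms by simp
    then show ?case using chain step by simp
  qed
  show "lars_selection X y k i"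
    unfolding lars_selection_def
  proof
    fix l assume l: "l \<in> {1..k}"
    then have "l - 1 < K" using assms by auto
    then show "frozen_argmax X y (pre i (l - 1)) (i l)"
      using max_le[of l] frozen_max_next_le_iff[of "l - 1" y] l by simp
  qed
qed

lemma lars_selection_iff_max_eq:
  assumes "1 \<le> k" "k \<le> K"
  shows "lars_selection X y (k + 1) i \<longleftrightarrow>
    frozen_max X y (pre i k) = frozen_at X y i (k + 1) \<and>
    (\<forall>l\<in>{1..k}. frozen_at X y i (l + 1) \<le> frozen_at X y i l)"
proof -
  have "lars_selection X y (k + 1) i \<longleftrightarrow>
      lars_selection X y k i \<and> frozen_max X y (pre i k) = frozen_at X y i (k + 1)"
    using frozen_argmax_iff[OF assms(2), of y]
    by (auto simp: lars_selection_def atLeastAtMostSuc_conv)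
  moreover have "{1..k} = insert k {1..<k}" using assms by auto
  ultimately show ?thesis
    unfolding lars_selection_iff_max_le[OF assms] by auto
qed

text \<open>
  Uniqueness is asked only at the steps where \<open>i\<close> itself attains the maximum; elsewhere the
  selection has already left \<open>i\<close>.
\<close>

definition argmax_unique :: "real^'n \<Rightarrow> bool" where
  "argmax_unique y \<longleftrightarrow> (\<forall>l\<in>{1..K}. \<forall>j.
     frozen_argmax X y (pre i (l - 1)) (i l) \<longrightarrow> frozen_argmax X y (pre i (l - 1)) j \<longrightarrow> j = i l)"

lemma lars_selection_unique:
  assumes u: "argmax_unique y" and m: "m \<le> K"
    and \<iota>: "lars_selection X y m \<iota>" and i: "lars_selection X y m i"
  shows "l \<in> {1..m} \<Longrightarrow> \<iota> l = i l"
proof (induction l rule: less_induct)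
  case (less l)
  then have "pre \<iota> (l - 1) = pre i (l - 1)" by (intro pre_cong) auto
  then show ?case
    using u \<iota> i less.prems m unfolding argmax_unique_def lars_selection_def by fastforce
qed

text \<open>
  Each step compares finitely many indices, and for each of them a tie with \<open>i\<^sub>l\<close> is a nontrivial
  affine equation for the noise by \<open>frozen_direction_inj\<close>.  The Irrepresentable Check is used here
  for the tuple that includes \<open>i\<^sub>l\<close>, so the argument stops at step \<open>K\<close>.
\<close>

lemma AE_argmax_unique:
  assumes G: "gaussian_noise M \<sigma> \<eta>" and Y: "\<And>\<omega>. \<omega> \<in> space M \<Longrightarrow> Y \<omega> = X *v \<beta>0 + \<eta> \<omega>"
  shows "AE \<omega> in M. argmax_unique (Y \<omega>)"
proof -
  have "AE \<omega> in M. frozen X (Y \<omega>) (pre i (l - 1)) j \<noteq> frozen X (Y \<omega>) (pre i (l - 1)) (i l)"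
    if l: "l \<in> {1..K}" and j: "j \<notin> set (pre i l)" for l j
  proof -
    define w where "w j = (1 / (1 - \<theta> X (pre i (l - 1)) j)) *\<^sub>R innovation X (pre i (l - 1)) j" for j
    have pre_l: "pre i l = pre i (l - 1) @ [i l]" using l pre_Suc[of i "l - 1"] by simp
    have l': "l - 1 \<le> K" "l \<le> K" using l by auto
    have frozen: "frozen X y (pre i (l - 1)) j = w j \<bullet> y" for y j
      by (subst frozen_eq_inner[OF invertible_pre[OF l'(1)]]) (simp add: w_def innovation_def)
    have "w j \<noteq> w (i l)"
      unfolding w_def
    proof (rule frozen_direction_inj)
      show "invertible_mat (R_sub X (pre i (l - 1)))" "invertible_mat (R_sub X (pre i (l - 1) @ [i l]))"
        using invertible_pre[OF l'(1)] invertible_pre[OF l'(2)] by (simp_all add: pre_l)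
      show "\<theta> X (pre i (l - 1)) (i l) < 1" "\<theta> X (pre i (l - 1)) j < 1"
        using \<theta>_pre_less_1_iff[OF l'(1)] next_notin_pre[OF l'(1)] l j by (auto simp: pre_l)
      show "\<theta> X (pre i (l - 1) @ [i l]) j \<noteq> 1"
        using \<theta>_pre_less_1_iff[OF l'(2), of j] j by (simp add: pre_l)
    qed
    then have "AE \<omega> in M. (w j - w (i l)) \<bullet> \<eta> \<omega> \<noteq> - ((w j - w (i l)) \<bullet> (X *v \<beta>0))"
      by (intro AE_gaussian_not_in_hyperplane[OF G]) simp
    then show ?thesis
    proof (rule AE_mp, intro AE_I2 impI)
      fix \<omega> assume "\<omega> \<in> space M" "(w j - w (i l)) \<bullet> \<eta> \<omega> \<noteq> - ((w j - w (i l)) \<bullet> (X *v \<beta>0))"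
      then show "frozen X (Y \<omega>) (pre i (l - 1)) j \<noteq> frozen X (Y \<omega>) (pre i (l - 1)) (i l)"
        unfolding frozen by (simp add: Y inner_diff_left inner_add_right)
    qed
  qed
  then have "AE \<omega> in M. \<forall>l\<in>{1..K}. \<forall>j\<in>- set (pre i l).
      frozen X (Y \<omega>) (pre i (l - 1)) j \<noteq> frozen X (Y \<omega>) (pre i (l - 1)) (i l)"
    by (intro AE_finite_allI) auto
  then show ?thesis
  proof (rule AE_mp, intro AE_I2 impI)
    fix \<omega> assume ne: "\<forall>l\<in>{1..K}. \<forall>j\<in>- set (pre i l).
      frozen X (Y \<omega>) (pre i (l - 1)) j \<noteq> frozen X (Y \<omega>) (pre i (l - 1)) (i l)"
    show "argmax_unique (Y \<omega>)"
      unfolding argmax_unique_def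
    proof (intro ballI allI impI)
      fix l j assume l: "l \<in> {1..K}" and a: "frozen_argmax X (Y \<omega>) (pre i (l - 1)) (i l)"
        "frozen_argmax X (Y \<omega>) (pre i (l - 1)) j"
      have "l - 1 \<le> K" using l by auto
      from a have "frozen X (Y \<omega>) (pre i (l - 1)) j = frozen X (Y \<omega>) (pre i (l - 1)) (i l)"
        by (auto simp: frozen_argmax_def is_arg_max_def intro: antisym leI)
      then have "j \<in> set (pre i l)" using ne l by blast
      moreover have "j \<notin> set (pre i (l - 1))"
        using a(2) \<theta>_pre_less_1_iff[OF \<open>l - 1 \<le> K\<close>] by (auto simp: frozen_argmax_def is_arg_max_def)
      ultimately show "j = i l"
        using pre_Suc[of i "l - 1"] l by simp
    qed
  qed
qed

end

section \<open>Independence of the frozen variables\<close>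

lemma sigma_hat_eq:
  fixes X :: "real^'p^'n"
  shows "sigma_hat X y is
    = norm (orth_residual (selected_span X is) y) / sqrt (real CARD('n) - real (length is))"
  by (simp add: sigma_hat_def orth_projection_complement subspace_selected_span)

text \<open>
  The basis is indexed by the coordinate type \<open>'n\<close>, so that the coordinates in it form a vector of
  the original type, to which the statements on Gaussian noise apply.
\<close>

lemma orthogonal_basis_extension:
  fixes S :: "(real^'n) set"
  assumes "pairwise real_inner_class.orthogonal S" "0 \<notin> S"
  obtains f :: "'n \<Rightarrow> real^'n" where "inj f" "S \<subseteq> range f" "0 \<notin> range f"
    "\<And>a b. a \<noteq> b \<Longrightarrow> f a \<bullet> f b = 0"
proof -
  obtain U where U: "U \<inter> insert 0 S = {}" "pairwise real_inner_class.orthogonal (S \<union> U)"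
    "span (S \<union> U) = span (S \<union> UNIV)"
    using orthogonal_extension_strong[OF assms(1)] by metis
  let ?W = "S \<union> U"
  have "0 \<notin> ?W" using U(1) assms(2) by auto
  then have ind: "independent ?W"
    using U(2) by (intro pairwise_orthogonal_independent)
  have "dim (UNIV :: (real^'n) set) = card ?W"
    using ind U(3) by (intro dim_unique[of ?W]) auto
  then have "card ?W = CARD('n)" by simp
  then obtain f where f: "bij_betw f (UNIV :: 'n set) ?W"
    using finite_same_card_bij[OF finite independent_imp_finite[OF ind]] by metis
  show thesis
  proof (rule that)
    show "inj f" "S \<subseteq> range f" "0 \<notin> range f"
      using f \<open>0 \<notin> ?W\<close> by (auto simp: bij_betw_def)
    show "f a \<bullet> f b = 0" if "a \<noteq> b" for a b
    proof -
      have "f a \<in> ?W" "f b \<in> ?W" "f a \<noteq> f b"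
        using f that by (auto simp: bij_betw_def inj_on_def)
      then show ?thesis
        using U(2) by (auto simp: pairwise_def real_inner_class.orthogonal_def)
    qed
  qed
qed

lemma selected_span_eq_span_innovations:
  "selected_span X (pre i k) = span ((\<lambda>l. innovation X (pre i (l - 1)) (i l)) ` {1..k})"
proof (induction k)
  case 0
  then show ?case by (simp add: pre_0 selected_span_def)
next
  case (Suc k)
  let ?U = "selected_span X (pre i k)" and ?x = "signed_column X (i (Suc k))"
  let ?u = "innovation X (pre i k) (i (Suc k))"
  have Px: "orth_projection ?U ?x \<in> ?U"
    by (simp add: orth_projection_in subspace_selected_span)
  have xu: "?x = orth_projection ?U ?x + ?u" by (simp add: innovation_def orth_residual_def)
  have "span (insert ?x ?U) = span (insert ?u ?U)"
  proof (intro subset_antisym span_minimal)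
    have "?x \<in> span (insert ?u ?U)"
      by (subst xu) (intro span_add span_base; use Px in simp)
    then show "insert ?x ?U \<subseteq> span (insert ?u ?U)" by (auto intro: span_base)
    have "?u \<in> span (insert ?x ?U)"
      unfolding innovation_def orth_residual_def by (intro span_diff span_base; use Px in simp)
    then show "insert ?u ?U \<subseteq> span (insert ?x ?U)" by (auto intro: span_base)
  qed simp_all
  moreover have "{1..Suc k} = insert (Suc k) {1..k}" by auto
  ultimately show ?case
    by (simp add: pre_Suc selected_span_snoc Suc.IH span_insert_span)
qed

text \<open>
  Normalized innovations, completed to an orthonormal basis: \<open>p l\<close> is the position of the \<open>l\<close>-th
  innovation, and the basis vectors at the other positions span the complement of the selected span.
\<close>

lemma innovation_basis:
  fixes X :: "real^'p^'n" and i :: "nat \<Rightarrow> 'p + 'p"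
  assumes inv: "\<And>l. l \<in> {1..k} \<Longrightarrow> invertible_mat (R_sub X (pre i l))"
  obtains e :: "'n \<Rightarrow> real^'n" and p :: "nat \<Rightarrow> 'n"
  where "\<And>a b. e a \<bullet> e b = (if a = b then 1 else 0)" and "inj_on p {1..k}"
    and "\<And>l a. l \<in> {1..k} \<Longrightarrow> a \<noteq> p l \<Longrightarrow> e a \<bullet> innovation X (pre i (l - 1)) (i l) = 0"
    and "\<And>a. a \<in> p ` {1..k} \<Longrightarrow> e a \<in> selected_span X (pre i k)"
    and "\<And>a z. a \<notin> p ` {1..k} \<Longrightarrow> z \<in> selected_span X (pre i k) \<Longrightarrow> e a \<bullet> z = 0"
proof -
  define u where "u l = innovation X (pre i (l - 1)) (i l)" for l
  have V: "selected_span X (pre i l) = span (u ` {1..l})" for l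
    by (simp add: selected_span_eq_span_innovations u_def)
  have u0: "u l \<noteq> 0" if "l \<in> {1..k}" for l
    using innovation_nonzero[of X "pre i (l - 1)" "i l"] inv[OF that] pre_Suc[of i "l - 1"] that
    by (simp add: u_def)
  have orth_less: "u l \<bullet> u m = 0" if "m < l" "m \<ge> 1" for l m
  proof -
    have "u m \<in> selected_span X (pre i (l - 1))"
      unfolding V using that by (intro span_base) auto
    then show ?thesis
      unfolding u_def[of l] innovation_def by (rule orth_residual_orth[OF subspace_selected_span])
  qed
  have orth: "u l \<bullet> u m = 0" if "l \<noteq> m" "l \<in> {1..k}" "m \<in> {1..k}" for l m
    using orth_less[of l m] orth_less[of m l] that by (cases l m rule: linorder_cases) (auto simp: inner_commute)
  have inj: "inj_on u {1..k}"
    using orth u0 by (metis inj_onI inner_eq_zero_iff)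
  obtain f :: "'n \<Rightarrow> real^'n" where f: "inj f" "u ` {1..k} \<subseteq> range f" "0 \<notin> range f"
    "\<And>a b. a \<noteq> b \<Longrightarrow> f a \<bullet> f b = 0"
  proof (rule orthogonal_basis_extension)
    show "pairwise real_inner_class.orthogonal (u ` {1..k})"
      unfolding pairwise_def real_inner_class.orthogonal_def
    proof (intro ballI impI)
      fix x y assume "x \<in> u ` {1..k}" "y \<in> u ` {1..k}" "x \<noteq> y"
      then obtain l m where "x = u l" "y = u m" "l \<in> {1..k}" "m \<in> {1..k}" "l \<noteq> m" by blast
      then show "x \<bullet> y = 0" using orth[of l m] by simp
    qed
    show "0 \<notin> u ` {1..k}" using u0 by auto
  qed (rule that)
  define e where "e a = (1 / norm (f a)) *\<^sub>R f a" for a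
  define p where "p l = inv_into UNIV f (u l)" for l
  have fp: "f (p l) = u l" if "l \<in> {1..k}" for l
    using f(2) that unfolding p_def by (intro f_inv_into_f) auto
  show thesis
  proof (rule that)
    show "e a \<bullet> e b = (if a = b then 1 else 0)" for a b
    proof (cases "a = b")
      case True
      moreover have "norm (f a) \<noteq> 0" using f(3) by (metis norm_eq_zero rangeI)
      ultimately show ?thesis by (simp add: e_def dot_square_norm power2_eq_square)
    qed (simp add: e_def f(4))
    show "inj_on p {1..k}"
      using inj fp by (metis inj_on_def)
    show "e a \<bullet> innovation X (pre i (l - 1)) (i l) = 0" if "l \<in> {1..k}" "a \<noteq> p l" for l a
      using f(4)[OF that(2)] fp[OF that(1)] by (simp add: e_def u_def)
    show "e a \<in> selected_span X (pre i k)" if "a \<in> p ` {1..k}" for a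
      unfolding e_def V using that fp by (auto intro: span_scale[OF span_base])
    show "e a \<bullet> z = 0" if a: "a \<notin> p ` {1..k}" and z: "z \<in> selected_span X (pre i k)" for a z
    proof -
      have "real_inner_class.orthogonal (e a) z"
      proof (rule orthogonal_to_span[of z "u ` {1..k}"])
        show "z \<in> span (u ` {1..k})" using z by (simp add: V)
        fix b assume "b \<in> u ` {1..k}"
        then obtain l where l: "l \<in> {1..k}" "b = u l" by blast
        then have "a \<noteq> p l" using a by blast
        then show "real_inner_class.orthogonal (e a) b"
          using f(4)[of a "p l"] fp[OF l(1)] l(2) by (simp add: e_def real_inner_class.orthogonal_def)
      qed
      then show ?thesis by (simp add: real_inner_class.orthogonal_def)
    qed
  qed
qed

text \<open>
  The transfer from the abstract families of events to random elements.  The predicate \<open>P\<close> stands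
  for dependence on a block of coordinates, alone or together with invariance under rescaling.
\<close>

lemma generated_subset_vimage:
  fixes F :: "real^'n \<Rightarrow> 'b"
  assumes F: "F \<in> borel \<rightarrow>\<^sub>M N" and f: "\<And>\<omega>. \<omega> \<in> space M \<Longrightarrow> f \<omega> = F (\<xi> \<omega>)"
    and P: "\<And>B. P (\<lambda>x. F x \<in> B)"
  shows "generated M N f \<subseteq> {\<xi> -` A \<inter> space M | A. A \<in> sets borel \<and> P (\<lambda>x. x \<in> A)}"
proof
  fix E assume "E \<in> generated M N f"
  moreover have "f \<in> space M \<rightarrow> space N"
    using measurable_space[OF F] by (auto simp: f)
  ultimately obtain B where B: "B \<in> sets N" "E = f -` B \<inter> space M"
    by (auto simp: generated_def sets_vimage_algebra2)
  have "E = \<xi> -` (F -` B) \<inter> space M" using B(2) by (auto simp: f)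
  moreover have "F -` B \<in> sets borel" using measurable_sets[OF F B(1)] by simp
  ultimately show "E \<in> {\<xi> -` A \<inter> space M | A. A \<in> sets borel \<and> P (\<lambda>x. x \<in> A)}"
    using P[of B] by (auto simp: vimage_def)
qed

lemma depends_on_comp: "depends_on J f \<Longrightarrow> depends_on J (\<lambda>x. g (f x))"
  unfolding depends_on_def by (intro allI impI arg_cong[where f = g]) blast

lemma depends_on_inner: "(\<And>a. a \<notin> J \<Longrightarrow> w $ a = 0) \<Longrightarrow> depends_on J (\<lambda>x. w \<bullet> x)"
  unfolding depends_on_def inner_vec_def
proof (intro allI impI sum.cong refl)
  fix x y :: "real^'a" and a
  assume "\<And>a. a \<notin> J \<Longrightarrow> w $ a = 0" "\<forall>a\<in>J. x $ a = y $ a"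
  then show "w $ a \<bullet> x $ a = w $ a \<bullet> y $ a" by (cases "a \<in> J") auto
qed

lemma depends_on_block_norm: "depends_on S (block_norm S)"
  unfolding depends_on_def block_norm_def by (auto cong: sum.cong)

lemma depends_on_restrict:
  "(\<And>j. j \<in> I \<Longrightarrow> depends_on J (\<lambda>x. G j x)) \<Longrightarrow> depends_on J (\<lambda>x. \<lambda>j\<in>I. G j x)"
  unfolding depends_on_def by (auto simp: fun_eq_iff restrict_def)

lemma depends_on_block_scale:
  assumes "depends_on J f" "J \<inter> S = {}"
  shows "f (block_scale S t x) = f x"
proof -
  have "\<forall>a\<in>J. block_scale S t x $ a = x $ a"
    using assms(2) by (auto simp: block_scale_def)
  then show ?thesis using assms(1) unfolding depends_on_def by blast
qed

text \<open>
  An intersection of scale invariant events is scale invariant, hence independent of the norm of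
  the block; its own probability factors because the blocks are disjoint.
\<close>

lemma gaussian_blocks_indep_block_norm:
  fixes \<xi> :: "'w \<Rightarrow> real^'n" and S :: "'n set" and J :: "nat \<Rightarrow> 'n set"
  assumes "prob_space M" and "\<sigma> > 0" and G: "gaussian_noise M \<sigma> \<xi>" and disj: "disjoint_family_on J {1..m}"
    and m: "m \<ge> 1"
  shows "prob_space.indep_sets M
    (\<lambda>l. if l = 0 then {\<xi> -` A \<inter> space M | A. A \<in> sets borel \<and> (\<exists>B\<in>sets borel. A = block_norm S -` B)}
         else {\<xi> -` A \<inter> space M | A. A \<in> sets borel \<and>
           (depends_on (J l) (\<lambda>x. x \<in> A) \<and> (\<forall>t>0. \<forall>x. block_scale S t x \<in> A \<longleftrightarrow> x \<in> A))}) {0..m}"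
    (is "prob_space.indep_sets M ?F _")
proof -
  interpret prob_space M by fact
  note \<xi> = gaussian_noise_measurable[OF G]
  have indep: "indep_sets ?F {1..m}"
    by (rule indep_sets_mono_sets[OF gaussian_blocks_indep[OF assms(1-4)]]) auto
  show ?thesis
  proof (subst indep_sets_finite)
    show "?F l \<subseteq> events" for l
      using measurable_sets[OF \<xi>] by auto
    show "space M \<in> ?F l" for l
    proof (cases "l = 0")
      case True
      then show ?thesis by (simp; intro exI[of _ UNIV]) (auto intro!: bexI[of _ UNIV])
    next
      case False
      then show ?thesis by (simp; intro exI[of _ UNIV]) (simp add: depends_on_def)
    qed
    show "\<forall>A\<in>Pi {0..m} ?F. prob (\<Inter>j\<in>{0..m}. A j) = (\<Prod>j\<in>{0..m}. prob (A j))"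
    proof
      fix A assume A: "A \<in> Pi {0..m} ?F"
      then have A: "A l \<in> ?F l" if "l \<in> {0..m}" for l
        using that by (rule Pi_mem)
      have "A 0 \<in> ?F 0" by (rule A) simp
      then obtain B where B: "B \<in> sets borel" "A 0 = {\<omega> \<in> space M. block_norm S (\<xi> \<omega>) \<in> B}"
        by auto
      have "\<forall>l\<in>{1..m}. \<exists>E. E \<in> sets borel \<and> A l = \<xi> -` E \<inter> space M \<and>
          (\<forall>t>0. \<forall>x. block_scale S t x \<in> E \<longleftrightarrow> x \<in> E)"
      proof
        fix l assume "l \<in> {1..m}"
        then have "A l \<in> ?F l" by (intro A) simp
        moreover have "l \<noteq> 0" using \<open>l \<in> {1..m}\<close> by simp
        ultimately show "\<exists>E. E \<in> sets borel \<and> A l = \<xi> -` E \<inter> space M \<and>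
          (\<forall>t>0. \<forall>x. block_scale S t x \<in> E \<longleftrightarrow> x \<in> E)"
          by auto
      qed
      then obtain E where E: "\<And>l. l \<in> {1..m} \<Longrightarrow> E l \<in> sets borel"
        "\<And>l. l \<in> {1..m} \<Longrightarrow> A l = \<xi> -` E l \<inter> space M"
        "\<And>l t x. l \<in> {1..m} \<Longrightarrow> t > 0 \<Longrightarrow> block_scale S t x \<in> E l \<longleftrightarrow> x \<in> E l"
        by metis
      let ?E = "\<Inter>l\<in>{1..m}. E l"
      have rest: "(\<Inter>l\<in>{1..m}. A l) = {\<omega> \<in> space M. \<xi> \<omega> \<in> ?E}"
        using E(2) m by auto
      have split: "{0..m} = insert 0 {1..m}" by auto
      have "(\<Inter>j\<in>{0..m}. A j) = {\<omega> \<in> space M. \<xi> \<omega> \<in> ?E \<and> block_norm S (\<xi> \<omega>) \<in> B}"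
        unfolding split using rest B(2) by auto
      also have "prob \<dots> = prob (\<Inter>l\<in>{1..m}. A l) * prob (A 0)"
        unfolding rest B(2)
      proof (rule block_scale_invariant_indep_block_norm[OF assms(1-3) _ _ B(1)])
        show "?E \<in> sets borel" using m E(1) by (intro sets.finite_INT) auto
        show "block_scale S t x \<in> ?E \<longleftrightarrow> x \<in> ?E" if "t > 0" for t x
          using E(3) that by auto
      qed
      also have "prob (\<Inter>l\<in>{1..m}. A l) = (\<Prod>l\<in>{1..m}. prob (A l))"
        using m by (intro indep_setsD[OF indep] ballI A) auto
      finally show "prob (\<Inter>j\<in>{0..m}. A j) = (\<Prod>j\<in>{0..m}. prob (A j))"
        unfolding split by simp
    qed
  qed auto
qed

text \<open>
  In innovation coordinates \<open>\<xi>\<close> every frozen variable is affine: \<open>Z\<close> at \<open>i\<^sub>l\<close> involves the coordinate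
  \<open>p l\<close> only, since its direction is the \<open>l\<close>-th innovation, and a variable frozen by all \<open>k\<close> indices
  involves none of these coordinates, since its direction is orthogonal to the selected span.
\<close>

lemma frozen_in_innovation_coordinates:
  fixes X :: "real^'p^'n" and i :: "nat \<Rightarrow> 'p + 'p"
  assumes G: "gaussian_noise M \<sigma> \<eta>" and Y: "\<And>\<omega>. \<omega> \<in> space M \<Longrightarrow> Y \<omega> = X *v \<beta>0 + \<eta> \<omega>"
    and inv: "\<And>l. l \<in> {1..k} \<Longrightarrow> invertible_mat (R_sub X (pre i l))"
  obtains \<xi> :: "'w \<Rightarrow> real^'n" and p :: "nat \<Rightarrow> 'n" and w :: "nat \<Rightarrow> real^'n" and v :: "'p + 'p \<Rightarrow> real^'n"
  where "gaussian_noise M \<sigma> \<xi>" and "inj_on p {1..k}"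
    and "\<And>l a. l \<in> {1..k} \<Longrightarrow> a \<noteq> p l \<Longrightarrow> w l $ a = 0"
    and "\<And>l \<omega>. l \<in> {1..k} \<Longrightarrow> \<omega> \<in> space M \<Longrightarrow> frozen_at X (Y \<omega>) i l =
      (innovation X (pre i (l - 1)) (i l) \<bullet> (X *v \<beta>0) + w l \<bullet> \<xi> \<omega>) / (1 - \<theta> X (pre i (l - 1)) (i l))"
    and "\<And>j a. a \<in> p ` {1..k} \<Longrightarrow> v j $ a = 0"
    and "\<And>j \<omega>. \<omega> \<in> space M \<Longrightarrow> frozen X (Y \<omega>) (pre i k) j =
      (innovation X (pre i k) j \<bullet> (X *v \<beta>0) + v j \<bullet> \<xi> \<omega>) / (1 - \<theta> X (pre i k) j)"
    and "\<And>\<omega>. norm (orth_residual (selected_span X (pre i k)) (\<eta> \<omega>)) = block_norm (- p ` {1..k}) (\<xi> \<omega>)"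
proof -
  let ?V = "selected_span X (pre i k)"
  obtain e :: "'n \<Rightarrow> real^'n" and p :: "nat \<Rightarrow> 'n" where e: "\<And>a b. e a \<bullet> e b = (if a = b then 1 else 0)"
    and p: "inj_on p {1..k}"
    and eu: "\<And>l a. l \<in> {1..k} \<Longrightarrow> a \<noteq> p l \<Longrightarrow> e a \<bullet> innovation X (pre i (l - 1)) (i l) = 0"
    and eV: "\<And>a. a \<in> p ` {1..k} \<Longrightarrow> e a \<in> ?V"
    and eV': "\<And>a z. a \<notin> p ` {1..k} \<Longrightarrow> z \<in> ?V \<Longrightarrow> e a \<bullet> z = 0"
    by (rule innovation_basis[OF inv]) (assumption | rule that)+
  define T where "T x = (\<chi> a. e a \<bullet> x)" for x
  have T: "orthogonal_transformation T"
    unfolding T_def[abs_def] by (rule orthonormal_coordinates_orthogonal_transformation[OF e])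
  have T_inner: "T x \<bullet> T y = x \<bullet> y" for x y
    using T by (simp add: orthogonal_transformation_def)
  have inv': "invertible_mat (R_sub X (pre i l))" if "l \<le> k" for l
    using inv[of l] that invertible_R_sub_Nil[of X] by (cases "l = 0") (auto simp: pre_0)
  have frozen: "frozen X (Y \<omega>) (pre i l) j =
      (innovation X (pre i l) j \<bullet> (X *v \<beta>0) + T (innovation X (pre i l) j) \<bullet> T (\<eta> \<omega>)) / (1 - \<theta> X (pre i l) j)"
    if "\<omega> \<in> space M" "l \<le> k" for \<omega> l j
    by (simp add: frozen_eq_inner[OF inv'[OF that(2)]] innovation_def Y[OF that(1)] T_inner inner_add_right)
  show thesis
  proof (rule that)
    show "gaussian_noise M \<sigma> (\<lambda>\<omega>. T (\<eta> \<omega>))"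
      unfolding T_def by (rule gaussian_noise_orthonormal_coordinates[OF G e])
    show "inj_on p {1..k}" by (rule p)
    show "T (innovation X (pre i (l - 1)) (i l)) $ a = 0" if "l \<in> {1..k}" "a \<noteq> p l" for l a
      using eu[OF that] by (simp add: T_def)
    show "frozen_at X (Y \<omega>) i l = (innovation X (pre i (l - 1)) (i l) \<bullet> (X *v \<beta>0)
        + T (innovation X (pre i (l - 1)) (i l)) \<bullet> T (\<eta> \<omega>)) / (1 - \<theta> X (pre i (l - 1)) (i l))"
      if "l \<in> {1..k}" "\<omega> \<in> space M" for l \<omega>
      unfolding frozen_at_def by (rule frozen) (use that in auto)
    show "T (innovation X (pre i k) j) $ a = 0" if "a \<in> p ` {1..k}" for j a
      using orth_residual_orth[OF subspace_selected_span eV[OF that], of "signed_column X j"]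
      by (simp add: T_def innovation_def inner_commute)
    show "frozen X (Y \<omega>) (pre i k) j = (innovation X (pre i k) j \<bullet> (X *v \<beta>0)
        + T (innovation X (pre i k) j) \<bullet> T (\<eta> \<omega>)) / (1 - \<theta> X (pre i k) j)"
      if "\<omega> \<in> space M" for j \<omega>
      by (rule frozen) (use that in auto)
    show "norm (orth_residual ?V (\<eta> \<omega>)) = block_norm (- p ` {1..k}) (T (\<eta> \<omega>))" for \<omega>
    proof -
      let ?r = "orth_residual ?V (\<eta> \<omega>)"
      have inside: "e a \<bullet> ?r = 0" if "a \<in> p ` {1..k}" for a
        using orth_residual_orth[OF subspace_selected_span eV[OF that]] by (simp add: inner_commute)
      have outside: "e a \<bullet> ?r = e a \<bullet> \<eta> \<omega>" if "a \<notin> p ` {1..k}" for a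
        using eV'[OF that orth_projection_in[OF subspace_selected_span]]
        by (simp add: orth_residual_def inner_diff_right)
      have "norm ?r = norm (T ?r)" by (simp add: orthogonal_transformation_norm[OF T])
      also have "\<dots> = sqrt (\<Sum>a\<in>UNIV. (e a \<bullet> ?r)\<^sup>2)"
        by (simp add: norm_vec_def L2_set_def T_def)
      also have "(\<Sum>a\<in>UNIV. (e a \<bullet> ?r)\<^sup>2) = (\<Sum>a\<in>- p ` {1..k}. (e a \<bullet> ?r)\<^sup>2)"
        using inside by (intro sum.mono_neutral_right) auto
      also have "\<dots> = (\<Sum>a\<in>- p ` {1..k}. (T (\<eta> \<omega>) $ a)\<^sup>2)"
        using outside by (intro sum.cong) (auto simp: T_def)
      finally show ?thesis by (simp add: block_norm_def)
    qed
  qed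
qed

lemma disjoint_family_on_singletons_and_rest:
  assumes p: "inj_on p {1..k}"
  shows "disjoint_family_on (\<lambda>l. if l \<in> {1..k} then {p l} else - p ` {1..k}) {1..k + 1 :: nat}"
  unfolding disjoint_family_on_def
proof (intro ballI impI)
  fix l m :: nat assume lm: "l \<in> {1..k + 1}" "m \<in> {1..k + 1}" "l \<noteq> m"
  show "(if l \<in> {1..k} then {p l} else - p ` {1..k}) \<inter> (if m \<in> {1..k} then {p m} else - p ` {1..k}) = {}"
  proof (cases "l \<in> {1..k}"; cases "m \<in> {1..k}")
    assume "l \<in> {1..k}" "m \<in> {1..k}"
    then show ?thesis using lm(3) inj_onD[OF p, of l m] by auto
  next
    assume "l \<notin> {1..k}" "m \<notin> {1..k}"
    then show ?thesis using lm by simp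
  qed auto
qed

lemma frozen_indep:
  fixes X :: "real^'p^'n" and i :: "nat \<Rightarrow> 'p + 'p"
  assumes M: "prob_space M" "\<sigma> > 0" and G: "gaussian_noise M \<sigma> \<eta>"
    and Y: "\<And>\<omega>. \<omega> \<in> space M \<Longrightarrow> Y \<omega> = X *v \<beta>0 + \<eta> \<omega>"
    and inv: "\<And>l. l \<in> {1..k} \<Longrightarrow> invertible_mat (R_sub X (pre i l))"
  shows "prob_space.indep_sets M
    (\<lambda>l. if l \<in> {1..k}
         then generated M borel (\<lambda>\<omega>. frozen_at X (Y \<omega>) i l)
         else generated M (\<Pi>\<^sub>M j\<in>I. borel) (\<lambda>\<omega>. \<lambda>j\<in>I. frozen X (Y \<omega>) (pre i k) j))
    {1..k+1}"
proof -
  interpret prob_space M by fact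
  obtain \<xi> :: "'a \<Rightarrow> real^'n" and p w v where \<xi>: "gaussian_noise M \<sigma> \<xi>" and p: "inj_on p {1..k}"
    and w: "\<And>l a. l \<in> {1..k} \<Longrightarrow> a \<noteq> p l \<Longrightarrow> w l $ a = 0"
    and frozen_at: "\<And>l \<omega>. l \<in> {1..k} \<Longrightarrow> \<omega> \<in> space M \<Longrightarrow> frozen_at X (Y \<omega>) i l =
      (innovation X (pre i (l - 1)) (i l) \<bullet> (X *v \<beta>0) + w l \<bullet> \<xi> \<omega>) / (1 - \<theta> X (pre i (l - 1)) (i l))"
    and v: "\<And>j a. a \<in> p ` {1..k} \<Longrightarrow> v j $ a = 0"
    and frozen: "\<And>j \<omega>. \<omega> \<in> space M \<Longrightarrow> frozen X (Y \<omega>) (pre i k) j =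
      (innovation X (pre i k) j \<bullet> (X *v \<beta>0) + v j \<bullet> \<xi> \<omega>) / (1 - \<theta> X (pre i k) j)"
    by (rule frozen_in_innovation_coordinates[OF G Y inv]) (assumption | rule that)+
  define J where "J l = (if l \<in> {1..k} then {p l} else - p ` {1..k})" for l
  have "disjoint_family_on J {1..k+1}"
    unfolding J_def by (rule disjoint_family_on_singletons_and_rest[OF p])
  then show ?thesis
  proof (rule indep_sets_mono_sets[OF gaussian_blocks_indep[OF M \<xi>]])
    fix l assume "l \<in> {1..k+1}"
    show "(if l \<in> {1..k}
         then generated M borel (\<lambda>\<omega>. frozen_at X (Y \<omega>) i l)
         else generated M (\<Pi>\<^sub>M j\<in>I. borel) (\<lambda>\<omega>. \<lambda>j\<in>I. frozen X (Y \<omega>) (pre i k) j))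
      \<subseteq> {\<xi> -` A \<inter> space M | A. A \<in> sets borel \<and> depends_on (J l) (\<lambda>x. x \<in> A)}"
    proof (cases "l \<in> {1..k}")
      case True
      let ?F = "\<lambda>x. (innovation X (pre i (l - 1)) (i l) \<bullet> (X *v \<beta>0) + w l \<bullet> x) / (1 - \<theta> X (pre i (l - 1)) (i l))"
      have "depends_on (J l) (\<lambda>x. ?F x \<in> B)" for B
        by (rule depends_on_comp[OF depends_on_inner]) (use w True in \<open>auto simp: J_def\<close>)
      then have "generated M borel (\<lambda>\<omega>. frozen_at X (Y \<omega>) i l)
          \<subseteq> {\<xi> -` A \<inter> space M | A. A \<in> sets borel \<and> depends_on (J l) (\<lambda>x. x \<in> A)}"
        using frozen_at[OF True] by (intro generated_subset_vimage[where F = ?F]) auto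
      then show ?thesis using True by simp
    next
      case False
      let ?F = "\<lambda>x. \<lambda>j\<in>I. (innovation X (pre i k) j \<bullet> (X *v \<beta>0) + v j \<bullet> x) / (1 - \<theta> X (pre i k) j)"
      have "depends_on (J l) (\<lambda>x. ?F x \<in> B)" for B
        by (intro depends_on_comp[where g = "\<lambda>z. z \<in> B"] depends_on_restrict,
            rule depends_on_comp[OF depends_on_inner]) (use v False in \<open>auto simp: J_def\<close>)
      then have "generated M (\<Pi>\<^sub>M j\<in>I. borel) (\<lambda>\<omega>. \<lambda>j\<in>I. frozen X (Y \<omega>) (pre i k) j)
          \<subseteq> {\<xi> -` A \<inter> space M | A. A \<in> sets borel \<and> depends_on (J l) (\<lambda>x. x \<in> A)}"
        using frozen by (intro generated_subset_vimage[where F = ?F]) (auto intro!: measurable_restrict)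
      then show ?thesis by (simp only: False if_False)
    qed
  qed
qed

text \<open>
  If the mean lies in the selected span, it vanishes in the residual.  The last block then consists
  of linear forms of the coordinates in \<open>S\<close>, and \<open>sigma_hat\<close> is the norm of these coordinates up to a
  constant; the quotients are homogeneous of degree 0 under rescaling of \<open>S\<close>.  At the origin of the
  block this also holds, the quotient being \<open>0 / 0 = 0\<close> before and after.
\<close>

lemma studentized_frozen_indep:
  fixes X :: "real^'p^'n" and i :: "nat \<Rightarrow> 'p + 'p"
  assumes M: "prob_space M" "\<sigma> > 0" and G: "gaussian_noise M \<sigma> \<eta>"
    and Y: "\<And>\<omega>. \<omega> \<in> space M \<Longrightarrow> Y \<omega> = X *v \<beta>0 + \<eta> \<omega>"
    and inv: "\<And>l. l \<in> {1..k} \<Longrightarrow> invertible_mat (R_sub X (pre i l))"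
    and \<beta>0: "X *v \<beta>0 \<in> selected_span X (pre i k)"
  shows "prob_space.indep_sets M
    (\<lambda>l. if l = 0
         then generated M borel (\<lambda>\<omega>. sigma_hat X (Y \<omega>) (pre i k))
         else if l \<in> {1..k}
         then generated M borel (\<lambda>\<omega>. frozen_at X (Y \<omega>) i l)
         else generated M (\<Pi>\<^sub>M j\<in>I. borel)
                (\<lambda>\<omega>. \<lambda>j\<in>I. frozen X (Y \<omega>) (pre i k) j / sigma_hat X (Y \<omega>) (pre i k)))
    {0..k+1}"
proof -
  interpret prob_space M by fact
  let ?V = "selected_span X (pre i k)"
  obtain \<xi> :: "'a \<Rightarrow> real^'n" and p w v where \<xi>: "gaussian_noise M \<sigma> \<xi>" and p: "inj_on p {1..k}"
    and w: "\<And>l a. l \<in> {1..k} \<Longrightarrow> a \<noteq> p l \<Longrightarrow> w l $ a = 0"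
    and frozen_at: "\<And>l \<omega>. l \<in> {1..k} \<Longrightarrow> \<omega> \<in> space M \<Longrightarrow> frozen_at X (Y \<omega>) i l =
      (innovation X (pre i (l - 1)) (i l) \<bullet> (X *v \<beta>0) + w l \<bullet> \<xi> \<omega>) / (1 - \<theta> X (pre i (l - 1)) (i l))"
    and v: "\<And>j a. a \<in> p ` {1..k} \<Longrightarrow> v j $ a = 0"
    and frozen: "\<And>j \<omega>. \<omega> \<in> space M \<Longrightarrow> frozen X (Y \<omega>) (pre i k) j =
      (innovation X (pre i k) j \<bullet> (X *v \<beta>0) + v j \<bullet> \<xi> \<omega>) / (1 - \<theta> X (pre i k) j)"
    and residual: "\<And>\<omega>. norm (orth_residual ?V (\<eta> \<omega>)) = block_norm (- p ` {1..k}) (\<xi> \<omega>)"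
    by (rule frozen_in_innovation_coordinates[OF G Y inv]) (assumption | rule that)+
  define S where "S = - p ` {1..k}"
  define s where "s = sqrt (real CARD('n) - real k)"
  have sigma_hat: "sigma_hat X (Y \<omega>) (pre i k) = block_norm S (\<xi> \<omega>) / s" if "\<omega> \<in> space M" for \<omega>
    using residual[of \<omega>]
    by (simp add: sigma_hat_eq length_pre Y[OF that] orth_residual_add[OF subspace_selected_span]
        orth_residual_eq_0[OF subspace_selected_span \<beta>0] S_def s_def)
  have frozen': "frozen X (Y \<omega>) (pre i k) j = (v j \<bullet> \<xi> \<omega>) / (1 - \<theta> X (pre i k) j)" if "\<omega> \<in> space M" for j \<omega>
    using orth_residual_orth[OF subspace_selected_span \<beta>0, of "signed_column X j"]
    by (simp add: frozen[OF that] innovation_def)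
  have v_scale: "v j \<bullet> block_scale S t x = t * (v j \<bullet> x)" for j t x
    unfolding inner_vec_def sum_distrib_left
    by (intro sum.cong) (auto simp: block_scale_def S_def v)
  define J where "J l = (if l \<in> {1..k} then {p l} else S)" for l
  define inv_dep where "inv_dep l f \<longleftrightarrow> depends_on (J l) f \<and> (\<forall>t>0. \<forall>x. f (block_scale S t x) \<longleftrightarrow> f x)"
    for l f
  have "disjoint_family_on J {1..k+1}"
    unfolding J_def S_def by (rule disjoint_family_on_singletons_and_rest[OF p])
  then show ?thesis
  proof (rule indep_sets_mono_sets[OF gaussian_blocks_indep_block_norm[OF M \<xi>, where S = S]])
    fix l assume l: "l \<in> {0..k+1}"
    show "(if l = 0
         then generated M borel (\<lambda>\<omega>. sigma_hat X (Y \<omega>) (pre i k))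
         else if l \<in> {1..k}
         then generated M borel (\<lambda>\<omega>. frozen_at X (Y \<omega>) i l)
         else generated M (\<Pi>\<^sub>M j\<in>I. borel)
                (\<lambda>\<omega>. \<lambda>j\<in>I. frozen X (Y \<omega>) (pre i k) j / sigma_hat X (Y \<omega>) (pre i k)))
      \<subseteq> (if l = 0 then {\<xi> -` A \<inter> space M | A. A \<in> sets borel \<and> (\<exists>B\<in>sets borel. A = block_norm S -` B)}
         else {\<xi> -` A \<inter> space M | A. A \<in> sets borel \<and>
           (depends_on (J l) (\<lambda>x. x \<in> A) \<and> (\<forall>t>0. \<forall>x. block_scale S t x \<in> A \<longleftrightarrow> x \<in> A))})"
    proof (cases "l = 0"; cases "l \<in> {1..k}")
      assume "l = 0" "l \<notin> {1..k}"
      have "E \<in> {\<xi> -` A \<inter> space M | A. A \<in> sets borel \<and> (\<exists>B\<in>sets borel. A = block_norm S -` B)}"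
        if E: "E \<in> generated M borel (\<lambda>\<omega>. sigma_hat X (Y \<omega>) (pre i k))" for E
      proof -
        obtain B where B: "B \<in> sets borel" "E = (\<lambda>\<omega>. sigma_hat X (Y \<omega>) (pre i k)) -` B \<inter> space M"
          using E by (auto simp: generated_def sets_vimage_algebra2)
        let ?B = "(\<lambda>r. r / s) -` B"
        have "?B \<in> sets borel" using measurable_sets[of "\<lambda>r. r / s" borel borel B] B(1) by simp
        moreover from this have "block_norm S -` ?B \<in> sets borel"
          using measurable_sets[OF borel_measurable_block_norm[of S]] by simp
        moreover have "E = \<xi> -` (block_norm S -` ?B) \<inter> space M"
          using B(2) by (auto simp: sigma_hat)
        ultimately show ?thesis by blast
      qed
      then show ?thesis using \<open>l = 0\<close> by auto
    next
      assume l0: "l \<noteq> 0" and True: "l \<in> {1..k}"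
      let ?F = "\<lambda>x. (innovation X (pre i (l - 1)) (i l) \<bullet> (X *v \<beta>0) + w l \<bullet> x) / (1 - \<theta> X (pre i (l - 1)) (i l))"
      have F: "depends_on (J l) ?F"
        by (rule depends_on_comp[OF depends_on_inner]) (use w True in \<open>auto simp: J_def\<close>)
      have "?F (block_scale S t x) = ?F x" for t x
        by (rule depends_on_block_scale[OF F]) (use True in \<open>auto simp: J_def S_def\<close>)
      then have "inv_dep l (\<lambda>x. ?F x \<in> B)" for B
        using depends_on_comp[OF F, of "\<lambda>z. z \<in> B"] by (simp only: inv_dep_def) simp
      then have "generated M borel (\<lambda>\<omega>. frozen_at X (Y \<omega>) i l)
          \<subseteq> {\<xi> -` A \<inter> space M | A. A \<in> sets borel \<and> inv_dep l (\<lambda>x. x \<in> A)}"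
        using frozen_at[OF True] by (intro generated_subset_vimage[where F = ?F]) auto
      then show ?thesis using True l0 by (simp add: inv_dep_def)
    next
      assume l0: "l \<noteq> 0" and False: "l \<notin> {1..k}"
      let ?F = "\<lambda>x. \<lambda>j\<in>I. ((v j \<bullet> x) / (1 - \<theta> X (pre i k) j)) / (block_norm S x / s)"
      have F: "depends_on (J l) ?F"
      proof (rule depends_on_restrict)
        fix j
        have "depends_on S (\<lambda>x. v j \<bullet> x)" by (rule depends_on_inner) (auto simp: S_def v)
        then show "depends_on (J l) (\<lambda>x. ((v j \<bullet> x) / (1 - \<theta> X (pre i k) j)) / (block_norm S x / s))"
          using depends_on_block_norm[of S] False unfolding depends_on_def J_def by metis
      qed
      have "?F (block_scale S t x) = ?F x" if "t > 0" for t x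
        using that by (simp add: v_scale block_norm_block_scale fun_eq_iff restrict_def)
      then have "inv_dep l (\<lambda>x. ?F x \<in> B)" for B
        using depends_on_comp[OF F, of "\<lambda>z. z \<in> B"] by (simp only: inv_dep_def) simp
      then have "generated M (\<Pi>\<^sub>M j\<in>I. borel)
            (\<lambda>\<omega>. \<lambda>j\<in>I. frozen X (Y \<omega>) (pre i k) j / sigma_hat X (Y \<omega>) (pre i k))
          \<subseteq> {\<xi> -` A \<inter> space M | A. A \<in> sets borel \<and> inv_dep l (\<lambda>x. x \<in> A)}"
        using frozen' sigma_hat
        by (intro generated_subset_vimage[where F = ?F]) (auto intro!: measurable_restrict cong: restrict_cong)
      then show ?thesis using False l0 by (simp add: inv_dep_def)
    qed simp
  qed simp
qed

text \<open>
  Fewer than \<open>n\<close> columns lie in a hyperplane, which the data almost surely avoid.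
\<close>

lemma AE_sigma_hat_pos:
  fixes X :: "real^'p^'n"
  assumes G: "gaussian_noise M \<sigma> \<eta>" and Y: "\<And>\<omega>. \<omega> \<in> space M \<Longrightarrow> Y \<omega> = X *v \<beta>0 + \<eta> \<omega>"
    and k: "length is < CARD('n)"
  shows "AE \<omega> in M. sigma_hat X (Y \<omega>) is > 0"
proof -
  let ?V = "selected_span X is"
  have "dim ?V < DIM(real^'n)" using dim_selected_span[of X "is"] k by simp
  then obtain z where z: "z \<noteq> 0" "\<And>y. y \<in> span ?V \<Longrightarrow> real_inner_class.orthogonal z y"
    by (rule orthogonal_to_subspace_exists) blast
  have "AE \<omega> in M. z \<bullet> \<eta> \<omega> \<noteq> - (z \<bullet> (X *v \<beta>0))"
    by (rule AE_gaussian_not_in_hyperplane[OF G z(1)])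
  then show ?thesis
  proof (rule AE_mp, intro AE_I2 impI)
    fix \<omega> assume \<omega>: "\<omega> \<in> space M" and ne: "z \<bullet> \<eta> \<omega> \<noteq> - (z \<bullet> (X *v \<beta>0))"
    have "orth_residual ?V (Y \<omega>) \<noteq> 0"
    proof
      assume "orth_residual ?V (Y \<omega>) = 0"
      then have "Y \<omega> \<in> ?V"
        using orth_projection_in[OF subspace_selected_span, of X "is" "Y \<omega>"] by (simp add: orth_residual_def)
      then have "z \<bullet> Y \<omega> = 0"
        using z(2)[OF span_base] by (simp add: real_inner_class.orthogonal_def)
      then show False using ne by (simp add: Y[OF \<omega>] inner_add_right)
    qed
    then show "sigma_hat X (Y \<omega>) is > 0"
      using k by (simp add: sigma_hat_eq)
  qed
qed

theorem proposition3:
  fixes M :: "'w measure"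
    and X :: "real^'p^'n" and \<beta>0 :: "real^'p"
    and Y \<eta> :: "'w \<Rightarrow> real^'n" and \<sigma> :: real
    and r K :: nat
    and \<iota> :: "'w \<Rightarrow> nat \<Rightarrow> 'p + 'p"
    and i :: "nat \<Rightarrow> 'p + 'p"
  assumes "prob_space M"
    and "rank X = r" and "r > 0"
    and "\<sigma> > 0"
    and "gaussian_noise M \<sigma> \<eta>"
    and "\<And>\<omega>. \<omega> \<in> space M \<Longrightarrow> Y \<omega> = X *v \<beta>0 + \<eta> \<omega>"
    and "1 \<le> K" and "K < min CARD('n) r"
    and "AE \<omega> in M. lars_selection X (Y \<omega>) (K + 1) (\<iota> \<omega>)"
    and "pre i (K + 1) \<in> signed_tuples (K + 1)"
  shows
    "(irrepresentable_check X (pre i K) \<longrightarrow>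
       (\<forall>k\<in>{1..K}.
          (k = K \<longrightarrow> (AE \<omega> in M. \<exists>!j. frozen_argmax X (Y \<omega>) (pre (\<iota> \<omega>) K) j)) \<longrightarrow>
          (AE \<omega> in M.
             (\<forall>l\<in>{1..k+1}. \<iota> \<omega> l = i l) \<longleftrightarrow>
             frozen_max X (Y \<omega>) (pre i k) = frozen_at X (Y \<omega>) i (k+1) \<and>
             (\<forall>l\<in>{1..k}. frozen_at X (Y \<omega>) i (l+1) \<le> frozen_at X (Y \<omega>) i l))) \<and>
       (\<forall>k\<in>{1..K}. \<forall>a<k.
          (AE \<omega> in M.
             (frozen_max X (Y \<omega>) (pre i k) = frozen_at X (Y \<omega>) i (k+1) \<and>
              (\<forall>l\<in>{1..k}. frozen_at X (Y \<omega>) i (l+1) \<le> frozen_at X (Y \<omega>) i l)) \<longleftrightarrow>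
             (frozen_max X (Y \<omega>) (pre i k) = frozen_at X (Y \<omega>) i (k+1) \<and>
              (\<forall>l\<in>{max 1 a..k}. frozen_at X (Y \<omega>) i (l+1) \<le> frozen_at X (Y \<omega>) i l) \<and>
              (a \<ge> 1 \<longrightarrow> frozen_at X (Y \<omega>) i a = frozen_max X (Y \<omega>) (pre i (a-1)))) \<and>
             (\<forall>l\<in>{max 1 a..k+1}. lars_knot X (Y \<omega>) (\<iota> \<omega>) l = frozen_at X (Y \<omega>) i l) \<and>
             (\<forall>l\<in>{1..a}. \<iota> \<omega> l = i l))))
     \<and>
     (\<forall>k\<in>{1..K}.
        (\<forall>l\<in>{1..k}. invertible_mat (R_sub X (pre i l))) \<longrightarrow>
        prob_space.indep_sets M
          (\<lambda>l. if l \<in> {1..k}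
               then generated M borel (\<lambda>\<omega>. frozen_at X (Y \<omega>) i l)
               else generated M (\<Pi>\<^sub>M j\<in>frozen_idx X (pre i k). borel)
                      (\<lambda>\<omega>. \<lambda>j\<in>frozen_idx X (pre i k). frozen X (Y \<omega>) (pre i k) j))
          {1..k+1})
     \<and>
     ((\<forall>l\<in>{1..K}. invertible_mat (R_sub X (pre i l))) \<longrightarrow>
      X *v \<beta>0 \<in> selected_span X (pre i K) \<longrightarrow>
        prob_space.indep_sets M
          (\<lambda>l. if l = 0
               then generated M borel (\<lambda>\<omega>. sigma_hat X (Y \<omega>) (pre i K))
               else if l \<in> {1..K}
               then generated M borel (\<lambda>\<omega>. frozen_at X (Y \<omega>) i l)
               else generated M (\<Pi>\<^sub>M j\<in>frozen_idx X (pre i K). borel)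
                      (\<lambda>\<omega>. \<lambda>j\<in>frozen_idx X (pre i K).
                         frozen X (Y \<omega>) (pre i K) j / sigma_hat X (Y \<omega>) (pre i K)))
          {0..K+1})
     \<and>
     (irrepresentable_check X (pre i K) \<longrightarrow>
        (AE \<omega> in M.
           (\<forall>l\<in>{1..K}. \<iota> \<omega> l = i l) \<longleftrightarrow>
           frozen_max X (Y \<omega>) (pre i K) \<le> frozen_at X (Y \<omega>) i K \<and>
           (\<forall>l\<in>{1..<K}. frozen_at X (Y \<omega>) i (l+1) \<le> frozen_at X (Y \<omega>) i l)) \<and>
        (AE \<omega> in M.
           (frozen_max X (Y \<omega>) (pre i K) \<le> frozen_at X (Y \<omega>) i K \<and>
            (\<forall>l\<in>{1..<K}. frozen_at X (Y \<omega>) i (l+1) \<le> frozen_at X (Y \<omega>) i l)) \<longleftrightarrow>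
           frozen_max X (Y \<omega>) (pre i K) / sigma_hat X (Y \<omega>) (pre i K)
             \<le> frozen_at X (Y \<omega>) i K / sigma_hat X (Y \<omega>) (pre i K) \<and>
           (\<forall>l\<in>{1..<K}. frozen_at X (Y \<omega>) i (l+1) / sigma_hat X (Y \<omega>) (pre i K)
                           \<le> frozen_at X (Y \<omega>) i l / sigma_hat X (Y \<omega>) (pre i K))))"
proof (intro conjI)
  have M: "prob_space M" and \<sigma>: "\<sigma> > 0" and G: "gaussian_noise M \<sigma> \<eta>"
    and Y: "\<And>\<omega>. \<omega> \<in> space M \<Longrightarrow> Y \<omega> = X *v \<beta>0 + \<eta> \<omega>"
    and K: "1 \<le> K" "K < CARD('n)"
    and sel: "AE \<omega> in M. lars_selection X (Y \<omega>) (K + 1) (\<iota> \<omega>)"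
    and tuple: "pre i (K + 1) \<in> signed_tuples (K + 1)"
    using assms by auto
  note path = irrepresentable_path.intro[OF _ tuple]
  show "irrepresentable_check X (pre i K) \<longrightarrow>
       (\<forall>k\<in>{1..K}.
          (k = K \<longrightarrow> (AE \<omega> in M. \<exists>!j. frozen_argmax X (Y \<omega>) (pre (\<iota> \<omega>) K) j)) \<longrightarrow>
          (AE \<omega> in M.
             (\<forall>l\<in>{1..k+1}. \<iota> \<omega> l = i l) \<longleftrightarrow>
             frozen_max X (Y \<omega>) (pre i k) = frozen_at X (Y \<omega>) i (k+1) \<and>
             (\<forall>l\<in>{1..k}. frozen_at X (Y \<omega>) i (l+1) \<le> frozen_at X (Y \<omega>) i l))) \<and>
       (\<forall>k\<in>{1..K}. \<forall>a<k.
          (AE \<omega> in M.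
             (frozen_max X (Y \<omega>) (pre i k) = frozen_at X (Y \<omega>) i (k+1) \<and>
              (\<forall>l\<in>{1..k}. frozen_at X (Y \<omega>) i (l+1) \<le> frozen_at X (Y \<omega>) i l)) \<longleftrightarrow>
             (frozen_max X (Y \<omega>) (pre i k) = frozen_at X (Y \<omega>) i (k+1) \<and>
              (\<forall>l\<in>{max 1 a..k}. frozen_at X (Y \<omega>) i (l+1) \<le> frozen_at X (Y \<omega>) i l) \<and>
              (a \<ge> 1 \<longrightarrow> frozen_at X (Y \<omega>) i a = frozen_max X (Y \<omega>) (pre i (a-1)))) \<and>
             (\<forall>l\<in>{max 1 a..k+1}. lars_knot X (Y \<omega>) (\<iota> \<omega>) l = frozen_at X (Y \<omega>) i l) \<and>
             (\<forall>l\<in>{1..a}. \<iota> \<omega> l = i l)))"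
  proof (intro impI conjI ballI allI)
    fix k assume check: "irrepresentable_check X (pre i K)" and k: "k \<in> {1..K}"
      and last: "k = K \<longrightarrow> (AE \<omega> in M. \<exists>!j. frozen_argmax X (Y \<omega>) (pre (\<iota> \<omega>) K) j)"
    interpret irrepresentable_path X i K by (rule path[OF check])
    have uniq: "AE \<omega> in M. argmax_unique (Y \<omega>)" by (rule AE_argmax_unique[OF G Y])
    have "AE \<omega> in M. k = K \<longrightarrow> (\<exists>!j. frozen_argmax X (Y \<omega>) (pre (\<iota> \<omega>) K) j)"
      using last by (cases "k = K") auto
    with sel uniq show "AE \<omega> in M.
           (\<forall>l\<in>{1..k+1}. \<iota> \<omega> l = i l) \<longleftrightarrow>
           frozen_max X (Y \<omega>) (pre i k) = frozen_at X (Y \<omega>) i (k+1) \<and>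
           (\<forall>l\<in>{1..k}. frozen_at X (Y \<omega>) i (l+1) \<le> frozen_at X (Y \<omega>) i l)"
    proof eventually_elim
      case (elim \<omega>)
      have k': "1 \<le> k" "k \<le> K" using k by auto
      have "(\<forall>l\<in>{1..k+1}. \<iota> \<omega> l = i l) \<longleftrightarrow> lars_selection X (Y \<omega>) (k + 1) i"
      proof
        assume "\<forall>l\<in>{1..k+1}. \<iota> \<omega> l = i l"
        then show "lars_selection X (Y \<omega>) (k + 1) i"
          using lars_selection_cong[OF lars_selection_mono[OF elim(1), of "k + 1"]] k' by simp
      next
        assume i: "lars_selection X (Y \<omega>) (k + 1) i"
        \<comment> \<open>step \<open>K + 1\<close> is beyond the reach of the check, so uniqueness there is the hypothesis on ties\<close>
        show "\<forall>l\<in>{1..k+1}. \<iota> \<omega> l = i l"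
        proof (cases "k = K")
          case False
          then show ?thesis
            using lars_selection_unique[OF elim(2) _ lars_selection_mono[OF elim(1)] i] k' by simp
        next
          case True
          have "lars_selection X (Y \<omega>) K i"
            using i by (auto simp: True lars_selection_def)
          then have eq: "\<iota> \<omega> l = i l" if "l \<in> {1..K}" for l
            using lars_selection_unique[OF elim(2) order_refl lars_selection_mono[OF elim(1)] _ that] by simp
          have pre: "pre (\<iota> \<omega>) K = pre i K" by (rule pre_cong[OF eq])
          have "frozen_argmax X (Y \<omega>) (pre i K) (i (K + 1))"
            using i unfolding True lars_selection_def by (auto dest!: bspec[where x = "K + 1"])
          moreover have "frozen_argmax X (Y \<omega>) (pre i K) (\<iota> \<omega> (K + 1))"
            using elim(1) pre unfolding lars_selection_def by (auto dest!: bspec[where x = "K + 1"])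
          ultimately have "\<iota> \<omega> (K + 1) = i (K + 1)"
            using elim(3) True pre by auto
          then show ?thesis
            using eq by (auto simp: True atLeastAtMostSuc_conv)
        qed
      qed
      then show ?case by (simp only: lars_selection_iff_max_eq[OF k'])
    qed
  next
    fix k a assume check: "irrepresentable_check X (pre i K)" and k: "k \<in> {1..K}" and a: "a < k"
    interpret irrepresentable_path X i K by (rule path[OF check])
    have uniq: "AE \<omega> in M. argmax_unique (Y \<omega>)" by (rule AE_argmax_unique[OF G Y])
    from sel uniq show "AE \<omega> in M.
           (frozen_max X (Y \<omega>) (pre i k) = frozen_at X (Y \<omega>) i (k+1) \<and>
            (\<forall>l\<in>{1..k}. frozen_at X (Y \<omega>) i (l+1) \<le> frozen_at X (Y \<omega>) i l)) \<longleftrightarrow>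
           (frozen_max X (Y \<omega>) (pre i k) = frozen_at X (Y \<omega>) i (k+1) \<and>
            (\<forall>l\<in>{max 1 a..k}. frozen_at X (Y \<omega>) i (l+1) \<le> frozen_at X (Y \<omega>) i l) \<and>
            (a \<ge> 1 \<longrightarrow> frozen_at X (Y \<omega>) i a = frozen_max X (Y \<omega>) (pre i (a-1)))) \<and>
           (\<forall>l\<in>{max 1 a..k+1}. lars_knot X (Y \<omega>) (\<iota> \<omega>) l = frozen_at X (Y \<omega>) i l) \<and>
           (\<forall>l\<in>{1..a}. \<iota> \<omega> l = i l)"
    proof eventually_elim
      case (elim \<omega>)
      have k': "1 \<le> k" "k \<le> K" using k by auto
      let ?max = "\<lambda>l. frozen_max X (Y \<omega>) (pre i l)" and ?Z = "frozen_at X (Y \<omega>) i"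
      show ?case
      proof (intro iffI conjI impI; (elim conjE)?)
        assume chain: "?max k = ?Z (k+1)" "\<forall>l\<in>{1..k}. ?Z (l+1) \<le> ?Z l"
        then have i: "lars_selection X (Y \<omega>) (k + 1) i"
          by (simp add: lars_selection_iff_max_eq[OF k', unfolded Suc_eq_plus1[symmetric]])
        then have "lars_selection X (Y \<omega>) k i" by (auto simp: lars_selection_def)
        then have eq: "\<iota> \<omega> l = i l" if "l \<in> {1..k}" for l
          using lars_selection_unique[OF elim(2) k'(2) lars_selection_mono[OF elim(1)] _ that] k' by simp
        have max: "?max (l - 1) = ?Z l" if "l \<in> {1..k+1}" for l
          using frozen_argmax_iff[of "l - 1" "Y \<omega>"] i that k' by (auto simp: lars_selection_def)
        show "?max k = ?Z (k+1)" by (rule chain)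
        show "\<forall>l\<in>{max 1 a..k}. ?Z (l+1) \<le> ?Z l" using chain by simp
        show "?Z a = ?max (a - 1)" if "1 \<le> a" using max[of a] that a by simp
        show "\<forall>l\<in>{1..a}. \<iota> \<omega> l = i l" using eq a by simp
        show "\<forall>l\<in>{max 1 a..k+1}. lars_knot X (Y \<omega>) (\<iota> \<omega>) l = ?Z l"
        proof
          fix l assume "l \<in> {max 1 a..k+1}"
          then have l: "l \<in> {1..k+1}" by simp
          then have "pre (\<iota> \<omega>) (l - 1) = pre i (l - 1)" by (intro pre_cong eq) auto
          then show "lars_knot X (Y \<omega>) (\<iota> \<omega>) l = ?Z l" using max[OF l] by (simp add: lars_knot_def)
        qed
      next
        assume chain: "?max k = ?Z (k+1)" "\<forall>l\<in>{max 1 a..k}. ?Z (l+1) \<le> ?Z l"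
          and eq: "\<forall>l\<in>{1..a}. \<iota> \<omega> l = i l"
        have i: "lars_selection X (Y \<omega>) a i"
          using lars_selection_cong[OF lars_selection_mono[OF elim(1), of a]] eq a k' by simp
        show "?max k = ?Z (k+1)" by (rule chain)
        show "\<forall>l\<in>{1..k}. ?Z (l+1) \<le> ?Z l"
        proof
          fix l assume l: "l \<in> {1..k}"
          show "?Z (l+1) \<le> ?Z l"
          proof (cases "l < a")
            case True
            have "?max a \<le> ?Z a \<and> (\<forall>l\<in>{1..<a}. ?Z (l+1) \<le> ?Z l)"
              using lars_selection_iff_max_le[of a "Y \<omega>"] i True a k' by simp
            then show ?thesis using True l by simp
          qed (use chain l in auto)
        qed
      qed
    qed
  qed
  show "\<forall>k\<in>{1..K}.
        (\<forall>l\<in>{1..k}. invertible_mat (R_sub X (pre i l))) \<longrightarrow>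
        prob_space.indep_sets M
          (\<lambda>l. if l \<in> {1..k}
               then generated M borel (\<lambda>\<omega>. frozen_at X (Y \<omega>) i l)
               else generated M (\<Pi>\<^sub>M j\<in>frozen_idx X (pre i k). borel)
                      (\<lambda>\<omega>. \<lambda>j\<in>frozen_idx X (pre i k). frozen X (Y \<omega>) (pre i k) j))
          {1..k+1}"
    using frozen_indep[OF M \<sigma> G Y] by blast
  show "(\<forall>l\<in>{1..K}. invertible_mat (R_sub X (pre i l))) \<longrightarrow>
      X *v \<beta>0 \<in> selected_span X (pre i K) \<longrightarrow>
        prob_space.indep_sets M
          (\<lambda>l. if l = 0
               then generated M borel (\<lambda>\<omega>. sigma_hat X (Y \<omega>) (pre i K))
               else if l \<in> {1..K}
               then generated M borel (\<lambda>\<omega>. frozen_at X (Y \<omega>) i l)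
               else generated M (\<Pi>\<^sub>M j\<in>frozen_idx X (pre i K). borel)
                      (\<lambda>\<omega>. \<lambda>j\<in>frozen_idx X (pre i K).
                         frozen X (Y \<omega>) (pre i K) j / sigma_hat X (Y \<omega>) (pre i K)))
          {0..K+1}"
    using studentized_frozen_indep[OF M \<sigma> G Y] by blast
  show "irrepresentable_check X (pre i K) \<longrightarrow>
        (AE \<omega> in M.
           (\<forall>l\<in>{1..K}. \<iota> \<omega> l = i l) \<longleftrightarrow>
           frozen_max X (Y \<omega>) (pre i K) \<le> frozen_at X (Y \<omega>) i K \<and>
           (\<forall>l\<in>{1..<K}. frozen_at X (Y \<omega>) i (l+1) \<le> frozen_at X (Y \<omega>) i l)) \<and>
        (AE \<omega> in M.
           (frozen_max X (Y \<omega>) (pre i K) \<le> frozen_at X (Y \<omega>) i K \<and>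
            (\<forall>l\<in>{1..<K}. frozen_at X (Y \<omega>) i (l+1) \<le> frozen_at X (Y \<omega>) i l)) \<longleftrightarrow>
           frozen_max X (Y \<omega>) (pre i K) / sigma_hat X (Y \<omega>) (pre i K)
             \<le> frozen_at X (Y \<omega>) i K / sigma_hat X (Y \<omega>) (pre i K) \<and>
           (\<forall>l\<in>{1..<K}. frozen_at X (Y \<omega>) i (l+1) / sigma_hat X (Y \<omega>) (pre i K)
                           \<le> frozen_at X (Y \<omega>) i l / sigma_hat X (Y \<omega>) (pre i K)))"
  proof (intro impI conjI)
    assume check: "irrepresentable_check X (pre i K)"
    interpret irrepresentable_path X i K by (rule path[OF check])
    have uniq: "AE \<omega> in M. argmax_unique (Y \<omega>)" by (rule AE_argmax_unique[OF G Y])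
    from sel uniq show "AE \<omega> in M.
           (\<forall>l\<in>{1..K}. \<iota> \<omega> l = i l) \<longleftrightarrow>
           frozen_max X (Y \<omega>) (pre i K) \<le> frozen_at X (Y \<omega>) i K \<and>
           (\<forall>l\<in>{1..<K}. frozen_at X (Y \<omega>) i (l+1) \<le> frozen_at X (Y \<omega>) i l)"
    proof eventually_elim
      case (elim \<omega>)
      have \<iota>: "lars_selection X (Y \<omega>) K (\<iota> \<omega>)" by (rule lars_selection_mono[OF elim(1)]) simp
      have "(\<forall>l\<in>{1..K}. \<iota> \<omega> l = i l) \<longleftrightarrow> lars_selection X (Y \<omega>) K i"
        using lars_selection_cong[OF \<iota>] lars_selection_unique[OF elim(2) order_refl \<iota>] by blast
      then show ?case by (simp only: lars_selection_iff_max_le[OF K(1) order_refl])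
    qed
    have "AE \<omega> in M. sigma_hat X (Y \<omega>) (pre i K) > 0"
      using K by (intro AE_sigma_hat_pos[OF G Y]) (simp_all add: length_pre)
    then show "AE \<omega> in M.
           (frozen_max X (Y \<omega>) (pre i K) \<le> frozen_at X (Y \<omega>) i K \<and>
            (\<forall>l\<in>{1..<K}. frozen_at X (Y \<omega>) i (l+1) \<le> frozen_at X (Y \<omega>) i l)) \<longleftrightarrow>
           frozen_max X (Y \<omega>) (pre i K) / sigma_hat X (Y \<omega>) (pre i K)
             \<le> frozen_at X (Y \<omega>) i K / sigma_hat X (Y \<omega>) (pre i K) \<and>
           (\<forall>l\<in>{1..<K}. frozen_at X (Y \<omega>) i (l+1) / sigma_hat X (Y \<omega>) (pre i K)
                           \<le> frozen_at X (Y \<omega>) i l / sigma_hat X (Y \<omega>) (pre i K))"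
      by eventually_elim (simp add: divide_le_cancel)
  qed
qed

end
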